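(* Let $\lambda$ be a partition. (1) If $\lambda=(\lambda_1,\lambda_2)$ with $\lambda_1\ge\lambda_2\ge1$, then $\langle S_\lambda\rangle>0$ unless $\lambda=(1,1)$. (2) If the conjugate partition of $\lambda$ is $\lambda'=(\mu_1,\mu_2)$ with $\mu_1\ge\mu_2\ge1$, then $\langle S_\lambda\rangle>0$ if and only if $\mu_1=\mu_2$ (in which case $\langle S_\lambda\rangle=2$) or $\mu_1=\mu_2+1$ (in which case $\langle S_\lambda\rangle=1$). (3) If $\lambda=(a+1,1^b)$ with integers $a,b\ge0$, then $\langle S_\lambda\rangle>0$ if and only if $a\ge\binom{b+1}{2}$.
   Context: Let $K$ be a field of characteristic $0$ and $P=K[X_1,X_2,\dots]$. For $w\in S_n$ let $X_i(w)$ be the number of $i$-cycles of $w$. For $q\in P$ let $\langle q\rangle_n=\frac1{n!}\sum_{w\in S_n}q(X_1(w),X_2(w),\dots)$; this is constant for large $n$ and the stable moment $\langle q\rangle$ denotes its eventually constant value. Define $H_d\in P$ ($d\ge0$) by $\sum_{d\ge0}H_dt^d=\prod_{i\ge1}(1-t^i)^{-X_i}$ in $P[[t]]$ (binomial series), $H_d=0$ for $d<0$, and for a partition $\lambda=(\lambda_1,\dots,\lambda_l)$ put $S_\lambda=\det(H_{\lambda_i+j-i})_{1\le i,j\le l}$. $S_\lambda$ is the character polynomial of the family of restrictions to $S_n$ (permutation matrices) of the Weyl modules $W_\lambda(K^n)$ (irreducible polynomial representation of $GL_n(K)$ of highest weight $\lambda$, or $0$ if $\lambda$ has more than $n$ parts),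 so $\langle S_\lambda\rangle=\dim W_\lambda(K^n)^{S_n}$ for all large $n$. Here $(a+1,1^b)$ is the hook partition with first part $a+1$ followed by $b$ parts equal to $1$. *)

theory Defs
  imports
    "HOL-Library.Poly_Mapping"
    "HOL-Computational_Algebra.Formal_Power_Series"
    "HOL-Combinatorics.Orbits"
    "HOL-Analysis.Infinite_Products"
    "Jordan_Normal_Form.Determinant"
begin

section \<open>The ring of character polynomials\<close>

text \<open>Monomials are finitely supported exponent functions. The variables are numbered from 0:
  number \<open>k\<close> is the variable written \<open>X_{k+1}\<close> in the literature.\<close>

type_synonym 'a charpoly = "(nat \<Rightarrow>\<^sub>0 nat) \<Rightarrow>\<^sub>0 'a"

definition const_cp :: "'a::field_char_0 \<Rightarrow> 'a charpoly" where
  "const_cp c = Poly_Mapping.single 0 c"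

definition var_cp :: "nat \<Rightarrow> 'a::field_char_0 charpoly" where
  "var_cp k = Poly_Mapping.single (Poly_Mapping.single k 1) 1"

definition eval_cp :: "(nat \<Rightarrow> 'a::field_char_0) \<Rightarrow> 'a charpoly \<Rightarrow> 'a" where
  "eval_cp x q = (\<Sum>m\<in>Poly_Mapping.keys q.
     Poly_Mapping.lookup q m * (\<Prod>k\<in>Poly_Mapping.keys m. x k ^ Poly_Mapping.lookup m k))"

section \<open>Moments\<close>

definition cycle_count :: "nat \<Rightarrow> (nat \<Rightarrow> nat) \<Rightarrow> nat \<Rightarrow> nat" where
  "cycle_count n w i = card {C \<in> orbit w ` {..<n}. card C = i}"

definition moment :: "'a::field_char_0 charpoly \<Rightarrow> nat \<Rightarrow> 'a" where
  "moment q n =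
     (\<Sum>w | w permutes {..<n}. eval_cp (\<lambda>k. of_nat (cycle_count n w (Suc k))) q) / fact n"

definition stable_moment :: "'a::field_char_0 charpoly \<Rightarrow> 'a" where
  "stable_moment q = (THE c. \<forall>\<^sub>F n in sequentially. moment q n = c)"

text \<open>A field of characteristic 0 need not be ordered. Stable moments of polynomials with rational
  coefficients lie in the prime field, and \<open>> 0\<close> refers to the order of the rationals.\<close>

definition rat_positive :: "'a::field_char_0 \<Rightarrow> bool" where
  "rat_positive c \<longleftrightarrow> (\<exists>r::rat. r > 0 \<and> c = of_rat r)"

section \<open>The polynomials \<open>H_d\<close> and \<open>S_\<lambda>\<close>\<close>

text \<open>The series \<open>(1 + t)^a\<close>. The library's \<open>gchoose\<close> and \<open>fps_binomial\<close> need
  coefficients in a ring with division, which a polynomial ring is not.\<close>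

definition binomial_series :: "'a::field_char_0 charpoly \<Rightarrow> 'a charpoly fps" where
  "binomial_series a = Abs_fps (\<lambda>k. const_cp (1 / fact k) * (\<Prod>j<k. a - of_nat j))"

text \<open>\<open>(1 - t^i)^(-X_i)\<close> for \<open>i = k + 1\<close>.\<close>

definition H_factor :: "nat \<Rightarrow> 'a::field_char_0 charpoly fps" where
  "H_factor k = fps_compose (binomial_series (- var_cp k)) (- (fps_X ^ Suc k))"

definition H_series :: "'a::field_char_0 charpoly fps" where
  "H_series = prodinf H_factor"

definition H_poly :: "int \<Rightarrow> 'a::field_char_0 charpoly" where
  "H_poly d = (if d < 0 then 0 else fps_nth H_series (nat d))"

definition S_poly :: "nat list \<Rightarrow> 'a::field_char_0 charpoly" where
  "S_poly lam = Determinant.det (Matrix.mat (length lam) (length lam)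
     (\<lambda>(i, j). H_poly (int (lam ! i) + int j - int i)))"

section \<open>Partitions\<close>

definition is_partition :: "nat list \<Rightarrow> bool" where
  "is_partition lam \<longleftrightarrow> sorted_wrt (\<ge>) lam \<and> 0 \<notin> set lam"

text \<open>The part with (0-based) number \<open>j\<close> of the conjugate is the number of parts exceeding \<open>j\<close>;
  there are as many parts as the largest part of the partition.\<close>

definition conj_partition :: "nat list \<Rightarrow> nat list" where
  "conj_partition lam = map (\<lambda>j. length (filter (\<lambda>p. j < p) lam)) [0..<foldr max lam 0]"

section \<open>Convergence of the infinite product\<close>

text \<open>The product converges in the \<open>t\<close>-adic topology, so \<open>prodinf\<close> is not a default value.\<close>

lemma H_factor_nth_0 [simp]: "fps_nth (H_factor k) 0 = 1"
  by (simp add: H_factor_def fps_compose_nth binomial_series_def const_cp_def)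

lemma H_factor_nth_le:
  assumes "0 < d" "d \<le> k"
  shows "fps_nth (H_factor k) d = 0"
proof -
  have "fps_nth ((- (fps_X ^ Suc k)) ^ i :: 'a charpoly fps) d = 0" for i
  proof (cases i)
    case 0
    then show ?thesis using assms by simp
  next
    case (Suc m)
    have "(- (fps_X ^ Suc k)) ^ i = ((-1) ^ i * fps_X ^ (Suc k * i) :: 'a charpoly fps)"
      by (subst power_minus) (simp only: power_mult)
    also have "\<dots> = fps_X ^ (Suc k * i) * (-1) ^ i"
      by (rule mult.commute)
    finally show ?thesis
      using assms Suc by (simp only: fps_X_power_mult_nth) auto
  qed
  then show ?thesis
    by (simp add: H_factor_def fps_compose_nth)
qed

lemma H_partial_product_stable:
  "fps_nth (\<Prod>k\<le>d + n. H_factor k :: 'a::field_char_0 charpoly fps) d =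
   fps_nth (\<Prod>k\<le>d. H_factor k) d"
proof (induction n)
  case (Suc n)
  define P where "P = (\<Prod>k\<le>d + n. H_factor k :: 'a charpoly fps)"
  have "fps_nth (P * H_factor (Suc (d + n))) d = (\<Sum>i=0..d. if i = d then fps_nth P d else 0)"
    unfolding fps_mult_nth by (intro sum.cong) (auto simp: H_factor_nth_le)
  then show ?case using Suc by (simp add: P_def)
qed simp

lemma H_factor_has_prod: "H_factor has_prod (H_series :: 'a::field_char_0 charpoly fps)"
proof -
  define L :: "'a charpoly fps" where "L = Abs_fps (\<lambda>d. fps_nth (\<Prod>k\<le>d. H_factor k) d)"
  have "(\<lambda>n. \<Prod>k\<le>n. H_factor k) \<longlonglongrightarrow> L"
  proof (rule tendsto_fpsI)
    fix d
    have "fps_nth (\<Prod>k\<le>n. H_factor k) d = fps_nth L d" if "n \<ge> d" for n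
      using H_partial_product_stable[where 'a = 'a, of d "n - d"] that by (simp add: L_def)
    then show "\<forall>\<^sub>F n in sequentially. fps_nth (\<Prod>k\<le>n. H_factor k) d = fps_nth L d"
      by (auto simp: eventually_sequentially)
  qed
  moreover have "fps_nth L 0 = 1"
    by (simp add: L_def)
  then have "L \<noteq> 0"
    by (metis fps_zero_nth zero_neq_one)
  ultimately have L: "H_factor has_prod L"
    by (simp add: has_prod_def raw_has_prod_def)
  show ?thesis
    unfolding H_series_def prodinf_def
  proof (rule theI)
    show "H_factor has_prod L" by (fact L)
  next
    fix M :: "'a charpoly fps"
    assume "H_factor has_prod M"
    moreover have "H_factor i \<noteq> (0 :: 'a charpoly fps)" for i
      by (metis H_factor_nth_0 fps_zero_nth zero_neq_one)
    ultimately have "(\<lambda>n. \<Prod>k\<le>n. H_factor k) \<longlonglongrightarrow> M"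
      by (simp add: has_prod_def raw_has_prod_def)
    then show "M = L"
      using \<open>(\<lambda>n. \<Prod>k\<le>n. H_factor k) \<longlonglongrightarrow> L\<close> by (rule LIMSEQ_unique)
  qed
qed

lemma H_series_nth:
  "fps_nth (H_series :: 'a::field_char_0 charpoly fps) d = fps_nth (\<Prod>k\<le>d. H_factor k) d"
proof -
  have "H_factor i \<noteq> (0 :: 'a charpoly fps)" for i
    by (metis H_factor_nth_0 fps_zero_nth zero_neq_one)
  then have "(\<lambda>n. \<Prod>k\<le>n. H_factor k) \<longlonglongrightarrow> (H_series :: 'a charpoly fps)"
    using H_factor_has_prod[where 'a = 'a] by (simp add: has_prod_def raw_has_prod_def)
  then obtain N where
    "\<forall>n\<ge>N. fps_nth (\<Prod>k\<le>n. H_factor k) d = fps_nth (H_series :: 'a charpoly fps) d"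
    unfolding tendsto_fps_iff eventually_sequentially by blast
  from this[rule_format, of "d + N"] show ?thesis
    by (simp add: H_partial_product_stable)
qed

end

theory Submission
  imports Defs
begin

text \<open>
  On \<open>S_n\<close> the polynomial \<open>H_d\<close> takes the value of the coefficient of \<open>t^d\<close> in the product of
  \<open>1 / (1 - t^c)\<close> over the cycle lengths \<open>c\<close>, which is the character of the \<open>d\<close>-th symmetric power of
  the permutation representation. Let \<open>E_d\<close> be the coefficient of \<open>t^d\<close> in the product of
  \<open>1 - (-t)^c\<close>, the character of the exterior power. For the three families of shapes the
  Jacobi-Trudi determinant reduces to products of two of these characters: two rows give
  \<open>H_a H_b - H_(a+1) H_(b-1)\<close> by definition, two columns give \<open>E_a E_b - E_(a+1) E_(b-1)\<close>, and
  hooks satisfy the Pieri rule \<open>S_(a|b+1) + S_(a+1|b) = H_(a+1) E_(b+1)\<close>. The last two follow by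
  induction from the expansion of the determinant along its last column, whose minors are again
  determinants of the same family.

  So everything rests on the moments of products of two such characters. Such a moment is a sum over
  all permutations of a product of one factor for each cycle. Removing a point from its cycle gives a
  recursion of Newton type for these sums, \<open>n z_n = (\<Sum>k=1..n. G_k z_(n-k))\<close>
  (\<open>cycle_sum_newton\<close>). The same recursion holds for the number of multisets of \<open>n\<close> vectors
  \<open>(i, j)\<close> with given sum, where a vector that is odd for the chosen pair of powers may occur only
  once (\<open>arrangements_newton\<close>), so the moment is that number (\<open>sum_cycle_series_coeffs\<close>). Discarding
  the zero vectors shows that it is constant for \<open>n \<ge> a + b\<close>.

  What remains is to count.
  For two exterior powers only the vectors \<open>(1, 1)\<close>, \<open>(1, 0)\<close> and \<open>(0, 1)\<close> occur, the last two at
  most once, and the values 2, 1 and 0 can be read off.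
  For one symmetric and one exterior power the multisets correspond to partitions of \<open>a + b\<close> with \<open>b\<close>
  marked part sizes. The Pieri rule and Pascal's rule then show that the moment of the hook \<open>(a|b)\<close>
  is the sum of \<open>(s - 1) choose b\<close> over all partitions of \<open>a + b + 1\<close>, where \<open>s\<close> is the number of
  different part sizes (\<open>stable_moment_hook\<close>). It is positive iff some partition of \<open>a + b + 1\<close> has
  \<open>b + 1\<close> different part sizes, that is, iff \<open>1 + 2 + \<dots> + (b + 1) \<le> a + b + 1\<close>.
  For two symmetric powers one compares two weight spaces of the polynomial ring in
  variables \<open>z_(i,j)\<close>, which is the symmetric algebra on all positive symmetric powers of the plane and so
  carries an action of \<open>sl_2\<close>. The composition of lowering and raising is injective on the weight space
  of \<open>(a + 1, b)\<close> for \<open>b \<le> a\<close>, hence the weight space of \<open>(a, b + 1)\<close> has larger dimension as soon as it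
  contains a highest weight vector (\<open>card_weight_monomials_less\<close>). For \<open>b + 1 \<le> a\<close>
  a product of four explicit highest weight vectors, with repetitions, has this weight, unless it is
  \<open>(1, 1)\<close>; and that shape is a hook.
\<close>

section \<open>Evaluating character polynomials at permutations\<close>

lemma poly_mapping_additive_induct [case_names single add]:
  fixes p :: "'k \<Rightarrow>\<^sub>0 'b::comm_monoid_add"
  assumes single: "\<And>k c. P (Poly_Mapping.single k c)" and add: "\<And>p q. P p \<Longrightarrow> P q \<Longrightarrow> P (p + q)"
  shows "P p"
proof -
  have "P (\<Sum>k\<in>K. Poly_Mapping.single k (Poly_Mapping.lookup p k))" if "finite K" for K
    using that
  proof (induction K)
    case empty
    then show ?case using single[of undefined 0] by simp
  qed (simp add: add single)
  moreover have "p = (\<Sum>k\<in>Poly_Mapping.keys p. Poly_Mapping.single k (Poly_Mapping.lookup p k))"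
    by (rule poly_mapping_eqI)
      (auto simp: lookup_sum lookup_single when_def sum.delta' not_in_keys_iff_lookup_eq_zero)
  ultimately show ?thesis by (metis finite_keys)
qed

definition monomial_value :: "(nat \<Rightarrow> 'a::comm_semiring_1) \<Rightarrow> (nat \<Rightarrow>\<^sub>0 nat) \<Rightarrow> 'a" where
  "monomial_value x m = (\<Prod>k\<in>Poly_Mapping.keys m. x k ^ Poly_Mapping.lookup m k)"

lemma monomial_value_superset:
  assumes "finite K" "Poly_Mapping.keys m \<subseteq> K"
  shows "monomial_value x m = (\<Prod>k\<in>K. x k ^ Poly_Mapping.lookup m k)"
  unfolding monomial_value_def using assms
  by (intro prod.mono_neutral_left) (auto simp: not_in_keys_iff_lookup_eq_zero)

lemma monomial_value_add: "monomial_value x (m + m') = monomial_value x m * monomial_value x m'"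
proof -
  let ?K = "Poly_Mapping.keys m \<union> Poly_Mapping.keys m'"
  have "monomial_value x k = (\<Prod>i\<in>?K. x i ^ Poly_Mapping.lookup k i)"
    if "k \<in> {m, m', m + m'}" for k
    using that keys_add[of m m'] by (intro monomial_value_superset) auto
  then show ?thesis by (simp add: lookup_add power_add prod.distrib)
qed

lemma eval_cp_monomial: "eval_cp x (Poly_Mapping.single m c) = c * monomial_value x m"
  by (cases "c = 0") (auto simp: eval_cp_def monomial_value_def)

lemma eval_cp_add: "eval_cp x (p + q) = eval_cp x p + eval_cp x q"
  unfolding eval_cp_def by (rule setsum_keys_plus_distrib) (auto simp: algebra_simps)

text \<open>It suffices to compare both sides on monomials, since both are additive in either factor.\<close>

lemma eval_cp_mult: "eval_cp x (p * q) = eval_cp x p * eval_cp x q"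
proof (induction p rule: poly_mapping_additive_induct)
  case (single k c)
  show ?case
  proof (induction q rule: poly_mapping_additive_induct)
    case (single k' c')
    show ?case by (simp add: mult_single eval_cp_monomial monomial_value_add)
  qed (simp add: distrib_left eval_cp_add)
qed (simp add: distrib_right eval_cp_add)

lemma eval_cp_const: "eval_cp x (const_cp c) = c"
  by (simp add: const_cp_def eval_cp_monomial monomial_value_def)

lemma eval_cp_var: "eval_cp x (var_cp k) = x k"
  by (simp add: var_cp_def eval_cp_monomial monomial_value_def)

lemma eval_cp_1: "eval_cp x 1 = 1"
  by (metis eval_cp_const const_cp_def single_one)

interpretation eval_cp: comm_ring_hom "eval_cp x"
proof
  show "eval_cp x 0 = 0" by (simp add: eval_cp_def)
qed (simp_all add: eval_cp_add eval_cp_mult eval_cp_1)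

lemma eval_cp_of_nat: "eval_cp x (of_nat n) = of_nat n"
  by (induction n) (simp_all add: eval_cp.hom_add)

lemma eval_cp_binomial_series:
  "eval_cp x (fps_nth (binomial_series a) k) = eval_cp x a gchoose k"
  by (simp add: binomial_series_def eval_cp.hom_mult eval_cp_const eval_cp.hom_prod
      eval_cp.hom_minus eval_cp_of_nat gbinomial_prod_rev atLeast0LessThan)

definition eval_fps :: "(nat \<Rightarrow> 'a::field_char_0) \<Rightarrow> 'a charpoly fps \<Rightarrow> 'a fps" where
  "eval_fps x F = Abs_fps (\<lambda>d. eval_cp x (fps_nth F d))"

lemma eval_fps_mult: "eval_fps x (F * G) = eval_fps x F * eval_fps x G"
  by (rule fps_ext) (simp add: eval_fps_def fps_mult_nth eval_cp.hom_sum eval_cp.hom_mult)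

lemma eval_fps_1: "eval_fps x 1 = 1"
  by (rule fps_ext) (auto simp: eval_fps_def eval_cp_1)

lemma eval_fps_prod: "eval_fps x (\<Prod>k\<in>K. F k) = (\<Prod>k\<in>K. eval_fps x (F k))"
  by (induction K rule: infinite_finite_induct) (simp_all add: eval_fps_1 eval_fps_mult)

lemma eval_fps_power: "eval_fps x (F ^ m) = eval_fps x F ^ m"
  by (induction m) (simp_all add: eval_fps_1 eval_fps_mult)

lemma eval_fps_uminus_X_power: "eval_fps x (- (fps_X ^ m)) = - (fps_X ^ m)"
  by (rule fps_ext) (auto simp: eval_fps_def fps_X_power_nth eval_cp.hom_uminus eval_cp_1)

lemma eval_fps_compose: "eval_fps x (F oo G) = eval_fps x F oo eval_fps x G"
proof (rule fps_ext)
  fix d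
  have "eval_cp x (fps_nth (G ^ i) d) = fps_nth (eval_fps x G ^ i) d" for i
    by (simp flip: eval_fps_power) (simp add: eval_fps_def)
  then show "fps_nth (eval_fps x (F oo G)) d = fps_nth (eval_fps x F oo eval_fps x G) d"
    by (simp add: fps_compose_nth eval_cp.hom_sum eval_cp.hom_mult) (simp add: eval_fps_def fps_compose_nth eval_cp.hom_sum eval_cp.hom_mult)
qed

text \<open>Evaluating \<open>X_{k+1}\<close> at the number of \<open>(k+1)\<close>-cycles turns the
  binomial series with a polynomial exponent into one with exponent \<open>-c\<close>, which is an
  honest power of the inverse of \<open>1 - t^(k+1)\<close>.\<close>

lemma eval_fps_H_factor:
  assumes "x k = of_nat c"
  shows "eval_fps x (H_factor k) = inverse (1 - fps_X ^ Suc k) ^ c"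
proof -
  have "eval_fps x (binomial_series (- var_cp k)) = fps_binomial (- of_nat c)"
    by (rule fps_ext) (simp add: eval_fps_def eval_cp_binomial_series eval_cp.hom_uminus eval_cp_var assms)
  then have "eval_fps x (H_factor k) = inverse ((1 + fps_X) ^ c) oo (- (fps_X ^ Suc k))"
    by (simp only: H_factor_def eval_fps_compose eval_fps_uminus_X_power fps_binomial_minus_of_nat)
  also have "\<dots> = inverse (((1 + fps_X) ^ c) oo (- (fps_X ^ Suc k)))"
    by (rule fps_inverse_compose) (auto simp: fps_X_power_nth)
  also have "((1 + fps_X :: 'a fps) ^ c) oo (- (fps_X ^ Suc k)) = ((1 + fps_X) oo (- (fps_X ^ Suc k))) ^ c"
    by (rule fps_compose_power[symmetric]) (simp add: fps_X_power_nth)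
  also have "(1 + fps_X) oo (- (fps_X ^ Suc k)) = (1 - fps_X ^ Suc k :: 'a fps)"
    by (subst fps_compose_add_distrib) (simp del: power_Suc)
  finally show ?thesis by (simp add: fps_inverse_power del: power_Suc)
qed

definition cycles :: "'b set \<Rightarrow> ('b \<Rightarrow> 'b) \<Rightarrow> 'b set set" where
  "cycles A w = orbit w ` A"

lemma card_cycle:
  assumes "finite A" "w permutes A" "C \<in> cycles A w"
  shows "1 \<le> card C" "card C \<le> card A"
proof -
  obtain a where a: "a \<in> A" "C = orbit w a" using assms by (auto simp: cycles_def)
  have sub: "C \<subseteq> A" using a assms(2) by (simp add: permutes_orbit_subset)
  then have "finite C" using assms(1) finite_subset by blast
  moreover have "C \<noteq> {}" using a orbit_nonempty by simp
  ultimately show "1 \<le> card C" by (simp add: Suc_leI card_gt_0_iff)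
  show "card C \<le> card A" using sub assms(1) by (rule card_mono[rotated])
qed

definition complete_series :: "'b set set \<Rightarrow> 'a::field_char_0 fps" where
  "complete_series Cs = (\<Prod>C\<in>Cs. inverse (1 - fps_X ^ card C))"

text \<open>The product of the factors \<open>H_factor k\<close> groups the cycles by length. Only the
  factors with \<open>k \<le> d\<close> are visible in degree \<open>d\<close>, but including
  those up to \<open>d + n\<close> makes the product run over all cycles.\<close>

lemma eval_cp_H_poly:
  assumes "w permutes {..<n}"
  shows "eval_cp (\<lambda>k. of_nat (cycle_count n w (Suc k))) (H_poly (int d)) =
    (fps_nth (complete_series (cycles {..<n} w)) d :: 'a::field_char_0)"
proof -
  define x :: "nat \<Rightarrow> 'a" where "x = (\<lambda>k. of_nat (cycle_count n w (Suc k)))"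
  let ?Cs = "cycles {..<n} w"
  have "eval_cp x (H_poly (int d)) = eval_cp x (fps_nth (\<Prod>k\<le>d + n. H_factor k) d)"
    by (simp add: H_poly_def H_series_nth H_partial_product_stable)
  also have "\<dots> = fps_nth (\<Prod>k\<le>d + n. eval_fps x (H_factor k)) d"
    by (simp flip: eval_fps_prod) (simp add: eval_fps_def)
  also have "(\<Prod>k\<le>d + n. eval_fps x (H_factor k)) =
      (\<Prod>k\<in>{..d + n}. \<Prod>C | C \<in> ?Cs \<and> card C - 1 = k. inverse (1 - fps_X ^ card C))"
  proof (rule prod.cong[OF refl])
    fix k
    have eq: "{C \<in> ?Cs. card C - 1 = k} = {C \<in> ?Cs. card C = Suc k}"
      using card_cycle(1)[OF _ assms] by fastforce
    have "eval_fps x (H_factor k) = inverse (1 - fps_X ^ Suc k) ^ cycle_count n w (Suc k)"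
      by (rule eval_fps_H_factor) (simp add: x_def)
    then show "eval_fps x (H_factor k) =
        (\<Prod>C | C \<in> ?Cs \<and> card C - 1 = k. inverse (1 - fps_X ^ card C))"
      unfolding eq by (simp add: cycle_count_def cycles_def del: power_Suc)
  qed
  also have "\<dots> = complete_series ?Cs"
    unfolding complete_series_def
  proof (rule prod.group)
    show "finite ?Cs" by (simp add: cycles_def)
    show "(\<lambda>C. card C - 1) ` ?Cs \<subseteq> {..d + n}" using card_cycle(2)[OF _ assms] by fastforce
  qed simp
  finally show ?thesis by (simp add: x_def)
qed

section \<open>Sums of cycle weights over a symmetric group\<close>

text \<open>Composing \<open>p\<close> with the transposition of \<open>a\<close> and \<open>b\<close> puts
  the new point \<open>a\<close> just before \<open>b\<close> in the cycle of \<open>b\<close>.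
  This describes every permutation of \<open>insert a A\<close> that moves \<open>a\<close> by one
  of \<open>A\<close>.\<close>

lemma orbit_insert_into_cycle:
  assumes "finite A" "p permutes A" "a \<notin> A" "b \<in> A"
  defines "w \<equiv> Transposition.transpose a b \<circ> p"
  shows "orbit w b = insert a (orbit p b)" "orbit w a = insert a (orbit p b)"
    "\<And>x. x \<in> A \<Longrightarrow> x \<notin> orbit p b \<Longrightarrow> orbit w x = orbit p x"
proof -
  have p: "permutation p" using assms permutation_permutes by blast
  have "w permutes insert a A"
    using assms unfolding w_def
    by (intro permutes_compose[OF permutes_subset[OF assms(2)] permutes_swap_id]) auto
  then have w: "permutation w" using assms(1) permutation_permutes by blast
  have sub: "orbit p x \<subseteq> A" if "x \<in> A" for x
    using that assms(2) by (rule permutes_orbit_subset[rotated])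
  have pa: "p a = a" using assms(2,3) by (simp add: permutes_not_in)
  have wa: "w a = b" by (simp add: w_def pa)
  have w_eq: "w y = p y" if "y \<in> A" "p y \<noteq> b" for y
    using that assms(3) permutes_in_image[OF assms(2), of y] by (auto simp: w_def Transposition.transpose_def)
  have w_b: "w y = a" if "p y = b" for y using that by (simp add: w_def)
  have b_orb: "b \<in> orbit p b" by (rule permutation_self_in_orbit[OF p])
  have a_in: "a \<in> orbit w b"
  proof -
    obtain y where y: "y = b \<or> y \<in> orbit p b" "p y = b" using b_orb by (cases rule: orbit.cases) metis+
    have "z \<in> orbit w b \<or> a \<in> orbit w b" if "z \<in> orbit p b" for z
      using that
    proof induction
      case base
      show ?case
      proof (cases "p b = b")
        case True
        then show ?thesis using orbit.base[of w b] w_b by auto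
      next
        case False
        then show ?thesis using orbit.base[of w b] w_eq[OF assms(4)] by auto
      qed
    next
      case (step z)
      have "z \<in> A" using step(1) sub[OF assms(4)] by blast
      then show ?case using step(2) w_eq[of z] w_b[of z] orbit.step[of z w b] by (cases "p z = b") auto
    qed
    with y show ?thesis using w_b[of y] orbit.base[of w b] orbit.step[of y w b] by auto
  qed
  then have b_in: "b \<in> orbit w b" using orbit.step[of a w b] wa by auto
  show orb_b: "orbit w b = insert a (orbit p b)"
  proof
    show "orbit w b \<subseteq> insert a (orbit p b)"
    proof
      fix z assume "z \<in> orbit w b"
      then show "z \<in> insert a (orbit p b)"
      proof induction
        case base
        then show ?case using w_b[of b] w_eq[OF assms(4)] orbit.base[of p b] by (cases "p b = b") auto
      next
        case (step z)
        show ?case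
        proof (cases "z = a")
          case False
          then have "z \<in> orbit p b" "z \<in> A" using step sub[OF assms(4)] by auto
          then show ?thesis using w_b[of z] w_eq[of z] orbit.step[of z p b] by (cases "p z = b") auto
        qed (use wa b_orb in auto)
      qed
    qed
    have "z \<in> orbit w b" if "z \<in> orbit p b" for z
      using that
    proof induction
      case base
      then show ?case using b_in w_eq[OF assms(4)] orbit.base[of w b] by (cases "p b = b") auto
    next
      case (step z)
      have "z \<in> A" using step(1) sub[OF assms(4)] by blast
      then show ?case using step(2) b_in w_eq[of z] orbit.step[of z w b] by (cases "p z = b") auto
    qed
    then show "insert a (orbit p b) \<subseteq> orbit w b" using a_in by auto
  qed
  have "orbit w a = orbit w b"
  proof
    show "orbit w a \<subseteq> orbit w b" using a_in orbit_trans by fast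
    have "b \<in> orbit w a" using orbit.base[of w a] wa by simp
    then show "orbit w b \<subseteq> orbit w a" using orbit_trans by fast
  qed
  with orb_b show "orbit w a = insert a (orbit p b)" by simp
  fix x assume x: "x \<in> A" "x \<notin> orbit p b"
  have "orbit p x = orbit w x"
  proof (rule orbit_cong0)
    show "x \<in> orbit p x" by (rule permutation_self_in_orbit[OF p])
    show "p \<in> orbit p x \<rightarrow> orbit p x" by (auto intro: orbit.step)
    fix y assume y: "y \<in> orbit p x"
    have "p y \<noteq> b"
    proof
      assume "p y = b"
      then have "b \<in> orbit p x" using y orbit.step by metis
      then have "x \<in> orbit p b" using orbit_swap[OF permutation_self_in_orbit[OF p]] by blast
      with x show False by simp
    qed
    then show "p y = w y" using w_eq[of y] y sub[OF x(1)] by auto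
  qed
  then show "orbit w x = orbit p x" by simp
qed

lemma orbits_disjoint:
  assumes "permutation p" "x \<in> orbit p b"
  shows "orbit p x = orbit p b"
proof
  show "orbit p x \<subseteq> orbit p b" using assms(2) orbit_trans by fast
  have "b \<in> orbit p x" using assms orbit_swap permutation_self_in_orbit by fast
  then show "orbit p b \<subseteq> orbit p x" using orbit_trans by fast
qed

lemma cycles_insert_fixed:
  assumes "p permutes A" "a \<notin> A"
  shows "orbit p a = {a}" "cycles (insert a A) p - {orbit p a} = cycles A p"
proof -
  show a: "orbit p a = {a}" using assms by (simp add: orbit_eq_singleton_iff permutes_not_in)
  have "{a} \<notin> cycles A p" using assms permutes_orbit_subset[OF assms(1)] by (fastforce simp: cycles_def)
  then show "cycles (insert a A) p - {orbit p a} = cycles A p" using a by (auto simp: cycles_def)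
qed

lemma cycles_insert_into_cycle:
  assumes "finite A" "p permutes A" "a \<notin> A" "b \<in> A"
  defines "w \<equiv> Transposition.transpose a b \<circ> p"
  shows "cycles (insert a A) w - {orbit w a} = cycles A p - {orbit p b}"
proof -
  note orb = orbit_insert_into_cycle[OF assms(1-4), folded w_def]
  have p: "permutation p" using assms permutation_permutes by blast
  have sub: "orbit p x \<subseteq> A" if "x \<in> A" for x
    using that assms(2) by (rule permutes_orbit_subset[rotated])
  have wi: "orbit w x = orbit w a" if "x \<in> orbit p b" for x
  proof -
    have "w permutes insert a A"
      using assms unfolding w_def
      by (intro permutes_compose[OF permutes_subset[OF assms(2)] permutes_swap_id]) auto
    then have "permutation w" using assms(1) permutation_permutes by blast
    moreover have "x \<in> orbit w a" using that orb(2) by simp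
    ultimately show ?thesis by (rule orbits_disjoint)
  qed
  have "a \<in> orbit w a" using orb(2) by simp
  then have ne: "orbit p x \<noteq> orbit w a" if "x \<in> A" for x using sub[OF that] assms(3) by blast
  show ?thesis
  proof (intro equalityI subsetI)
    fix C assume C: "C \<in> cycles (insert a A) w - {orbit w a}"
    then obtain x where x: "x \<in> A" "C = orbit w x" "orbit w x \<noteq> orbit w a" by (auto simp: cycles_def)
    then have "x \<notin> orbit p b" using wi by blast
    moreover have "x \<in> orbit p x" by (rule permutation_self_in_orbit[OF p])
    ultimately show "C \<in> cycles A p - {orbit p b}" using x orb(3)[OF x(1)] by (auto simp: cycles_def)
  next
    fix C assume "C \<in> cycles A p - {orbit p b}"
    then obtain x where x: "x \<in> A" "C = orbit p x" "orbit p x \<noteq> orbit p b" by (auto simp: cycles_def)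
    then have "x \<notin> orbit p b" using orbits_disjoint[OF p] by blast
    then show "C \<in> cycles (insert a A) w - {orbit w a}"
      using x orb(3)[OF x(1)] ne[OF x(1)] by (auto simp: cycles_def)
  qed
qed

definition cycle_sum :: "(nat \<Rightarrow> 'r::comm_ring_1) \<Rightarrow> 'b set \<Rightarrow> 'r" where
  "cycle_sum G A = (\<Sum>w | w permutes A. \<Prod>C\<in>cycles A w. G (card C))"

text \<open>Giving the cycle through a chosen point a weight function \<open>F\<close> of its own makes the
  recursion close up: when \<open>a\<close> is removed from its cycle, the remaining cycle is one
  shorter and has to remember it, which a shift of \<open>F\<close> does.\<close>

definition pointed_cycle_sum ::
    "(nat \<Rightarrow> 'r::comm_ring_1) \<Rightarrow> (nat \<Rightarrow> 'r) \<Rightarrow> 'b set \<Rightarrow> 'b \<Rightarrow> 'r" where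
  "pointed_cycle_sum G F A a =
    (\<Sum>w | w permutes A. F (card (orbit w a)) * (\<Prod>C\<in>cycles A w - {orbit w a}. G (card C)))"

lemma pointed_cycle_sum_same:
  assumes "finite A" "a \<in> A"
  shows "pointed_cycle_sum G G A a = cycle_sum G A"
  unfolding pointed_cycle_sum_def cycle_sum_def
proof (rule sum.cong[OF refl])
  fix w
  have "finite (cycles A w)" "orbit w a \<in> cycles A w" using assms by (auto simp: cycles_def)
  from prod.remove[OF this, of "\<lambda>C. G (card C)"]
  show "G (card (orbit w a)) * (\<Prod>C\<in>cycles A w - {orbit w a}. G (card C)) =
      (\<Prod>C\<in>cycles A w. G (card C))" by simp
qed

text \<open>Either \<open>a\<close> is fixed, or it sits in front of some \<open>b \<in> A\<close> and makes
  the cycle of \<open>b\<close> longer by one.\<close>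

lemma pointed_cycle_sum_insert:
  assumes "finite A" "a \<notin> A"
  shows "pointed_cycle_sum G F (insert a A) a =
    F 1 * cycle_sum G A + (\<Sum>b\<in>A. pointed_cycle_sum G (\<lambda>k. F (Suc k)) A b)"
proof -
  let ?t = "\<lambda>w. F (card (orbit w a)) * (\<Prod>C\<in>cycles (insert a A) w - {orbit w a}. G (card C))"
  have "pointed_cycle_sum G F (insert a A) a =
      (\<Sum>b\<in>insert a A. \<Sum>p | p permutes A. ?t (Transposition.transpose a b \<circ> p))"
    unfolding pointed_cycle_sum_def by (rule sum_over_permutations_insert[OF assms])
  also have "\<dots> = (\<Sum>p | p permutes A. ?t p) + (\<Sum>b\<in>A. \<Sum>p | p permutes A. ?t (Transposition.transpose a b \<circ> p))"
    using assms by simp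
  also have "(\<Sum>p | p permutes A. ?t p) = F 1 * cycle_sum G A"
    unfolding cycle_sum_def sum_distrib_left
    using cycles_insert_fixed[OF _ assms(2)] by (intro sum.cong refl) auto
  also have "(\<Sum>b\<in>A. \<Sum>p | p permutes A. ?t (Transposition.transpose a b \<circ> p)) =
      (\<Sum>b\<in>A. pointed_cycle_sum G (\<lambda>k. F (Suc k)) A b)"
    unfolding pointed_cycle_sum_def
  proof (intro sum.cong refl)
    fix b p assume b: "b \<in> A" and "p \<in> {p. p permutes A}"
    then have p: "p permutes A" by simp
    have sub: "orbit p b \<subseteq> A" by (rule permutes_orbit_subset[OF p b])
    then have "finite (orbit p b)" "a \<notin> orbit p b" using assms finite_subset by auto
    then have "card (orbit (Transposition.transpose a b \<circ> p) a) = Suc (card (orbit p b))"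
      by (simp add: orbit_insert_into_cycle(2)[OF assms(1) p assms(2) b])
    then show "?t (Transposition.transpose a b \<circ> p) =
        F (Suc (card (orbit p b))) * (\<Prod>C\<in>cycles A p - {orbit p b}. G (card C))"
      by (simp only: cycles_insert_into_cycle[OF assms(1) p assms(2) b])
  qed
  finally show ?thesis .
qed

text \<open>The sums divided by \<open>n!\<close> are the complete homogeneous symmetric functions when
  \<open>G_k\<close> is the power sum of degree \<open>k\<close>, and the hypothesis is Newton's
  identity. A cycle of length \<open>k\<close> through a given point can be chosen in
  \<open>(n-1)! / (n-k)!\<close> ways, and the other points contribute
  \<open>(n-k)! z_(n-k)\<close>; hence the formula for pointed sums that the induction carries
  along.\<close>

theorem cycle_sum_newton:
  fixes G z :: "nat \<Rightarrow> 'r::comm_ring_1"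
  assumes "finite A" and z0: "z 0 = 1"
    and newton: "\<And>n. of_nat (Suc n) * z (Suc n) = (\<Sum>k=1..Suc n. G k * z (Suc n - k))"
  shows "cycle_sum G A = of_nat (fact (card A)) * z (card A)"
proof -
  have "cycle_sum G A = of_nat (fact n) * z n \<and> (\<forall>F. \<forall>a\<in>A.
      pointed_cycle_sum G F A a = of_nat (fact (n - 1)) * (\<Sum>k=1..n. F k * z (n - k)))"
    if "finite A" "card A = n" for n and A :: "'b set"
    using that
  proof (induction n arbitrary: A)
    case 0
    then show ?case by (simp add: cycle_sum_def cycles_def z0)
  next
    case (Suc n)
    \<comment> \<open>The inductive formula is used for the shifted weight, at each of the \<open>n\<close> possible successors of \<open>a\<close>.\<close>
    have pointed: "pointed_cycle_sum G F A a = of_nat (fact n) * (\<Sum>k=1..Suc n. F k * z (Suc n - k))"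
      if "a \<in> A" for F a
    proof -
      have AB: "finite (A - {a})" "card (A - {a}) = n" "insert a (A - {a}) = A"
        using that Suc.prems by auto
      have fact_n: "of_nat n * of_nat (fact (n - 1)) = (of_nat (fact n) :: 'r)" if "n > 0"
        using that by (cases n) (auto simp: algebra_simps)
      have "pointed_cycle_sum G F A a = F 1 * (of_nat (fact n) * z n) +
          (\<Sum>b\<in>A - {a}. of_nat (fact (n - 1)) * (\<Sum>k=1..n. F (Suc k) * z (n - k)))"
        using pointed_cycle_sum_insert[OF AB(1), of a G F, unfolded AB(3)] Suc.IH[OF AB(1,2)]
        by simp
      also have "\<dots> = of_nat (fact n) * (F 1 * z n) + of_nat (fact n) * (\<Sum>k=1..n. F (Suc k) * z (n - k))"
        using fact_n by (cases "n = 0") (simp_all add: AB(2) mult.left_commute flip: fact_n mult.assoc)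
      also have "\<dots> = of_nat (fact n) * (F 1 * z n + (\<Sum>k=1..n. F (Suc k) * z (n - k)))"
        by (simp add: distrib_left)
      also have "F 1 * z n + (\<Sum>k=1..n. F (Suc k) * z (n - k)) = (\<Sum>k=1..Suc n. F k * z (Suc n - k))"
        by (subst sum.atLeast_Suc_atMost) (simp_all only: sum.shift_bounds_cl_Suc_ivl One_nat_def, simp_all)
      finally show ?thesis .
    qed
    moreover have "cycle_sum G A = of_nat (fact (Suc n)) * z (Suc n)"
    proof -
      obtain a where a: "a \<in> A" using Suc.prems by fastforce
      have "cycle_sum G A = of_nat (fact n) * (of_nat (Suc n) * z (Suc n))"
        using pointed[OF a, of G] unfolding newton
        by (simp add: pointed_cycle_sum_same[OF Suc.prems(1) a])
      then show ?thesis by (simp add: algebra_simps)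
    qed
    ultimately show ?case by simp
  qed
  then show ?thesis using assms(1) by blast
qed

section \<open>Jacobi-Trudi determinants of hooks and two-column shapes\<close>

definition extend_by_0 :: "(nat \<Rightarrow> 'r::zero) \<Rightarrow> int \<Rightarrow> 'r" where
  "extend_by_0 h d = (if d < 0 then 0 else h (nat d))"

definition jacobi_trudi_mat :: "(nat \<Rightarrow> 'r::comm_ring_1) \<Rightarrow> nat list \<Rightarrow> 'r mat" where
  "jacobi_trudi_mat h lam = Matrix.mat (length lam) (length lam)
     (\<lambda>(i, j). extend_by_0 h (int (lam ! i) + int j - int i))"

definition jacobi_trudi :: "(nat \<Rightarrow> 'r::comm_ring_1) \<Rightarrow> nat list \<Rightarrow> 'r" where
  "jacobi_trudi h lam = Determinant.det (jacobi_trudi_mat h lam)"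

lemma jacobi_trudi_mat_carrier: "jacobi_trudi_mat h lam \<in> carrier_mat (length lam) (length lam)"
  by (simp add: jacobi_trudi_mat_def)

lemma jacobi_trudi_mat_nth:
  "i < length lam \<Longrightarrow> j < length lam \<Longrightarrow>
   jacobi_trudi_mat h lam $$ (i, j) = extend_by_0 h (int (lam ! i) + int j - int i)"
  by (simp add: jacobi_trudi_mat_def)

lemma jacobi_trudi_Nil: "jacobi_trudi h [] = 1"
  by (simp add: jacobi_trudi_def jacobi_trudi_mat_def)

text \<open>The last row of the larger matrix is \<open>(0, \<dots>, 0, 1)\<close>.\<close>

lemma jacobi_trudi_append_0:
  assumes "h 0 = 1"
  shows "jacobi_trudi h (lam @ [0]) = jacobi_trudi h lam"
proof -
  let ?N = "length lam" and ?A = "jacobi_trudi_mat h (lam @ [0])"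
  have A: "?A \<in> carrier_mat (Suc ?N) (Suc ?N)" using jacobi_trudi_mat_carrier[of h "lam @ [0]"] by simp
  have last_row: "?A $$ (?N, j) = (if j = ?N then 1 else 0)" if "j \<le> ?N" for j
    using that assms by (auto simp: jacobi_trudi_mat_nth extend_by_0_def)
  have "jacobi_trudi h (lam @ [0]) = (\<Sum>j<Suc ?N. ?A $$ (?N, j) * cofactor ?A ?N j)"
    unfolding jacobi_trudi_def by (rule laplace_expansion_row[OF A]) simp
  also have "\<dots> = (\<Sum>j<Suc ?N. if j = ?N then cofactor ?A ?N ?N else 0)"
    by (rule sum.cong[OF refl]) (auto simp: last_row)
  also have "\<dots> = Determinant.det (mat_delete ?A ?N ?N)"
    by (simp add: cofactor_def)
  also have "mat_delete ?A ?N ?N = jacobi_trudi_mat h lam"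
    by (rule eq_matI) (auto simp: mat_delete_def jacobi_trudi_mat_def nth_append)
  finally show ?thesis by (simp add: jacobi_trudi_def)
qed

lemma jacobi_trudi_append_zeros:
  assumes "h 0 = 1"
  shows "jacobi_trudi h (lam @ replicate k 0) = jacobi_trudi h lam"
proof (induction k)
  case (Suc k)
  have "lam @ replicate (Suc k) 0 = (lam @ replicate k 0) @ [0]"
    by (simp add: replicate_append_same)
  then show ?case using Suc jacobi_trudi_append_0[of h, OF assms] by metis
qed simp

text \<open>Deleting row \<open>i\<close> moves the later rows up by one, which has the same effect on the
  index \<open>\<lambda>_r + c - r\<close> as lowering the part by one. So the minors are again
  Jacobi-Trudi determinants; in the shapes below a part 1 becomes a trailing 0, which does not
  change the determinant.\<close>

lemma jacobi_trudi_expand_last_column: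
  assumes "length lam = Suc m" "0 \<notin> set lam"
  shows "jacobi_trudi h lam = (\<Sum>i<Suc m. (-1) ^ (m - i) * h (lam ! i + (m - i)) *
    jacobi_trudi h (take i lam @ map (\<lambda>p. p - 1) (drop (Suc i) lam)))"
proof -
  let ?A = "jacobi_trudi_mat h lam"
  have A: "?A \<in> carrier_mat (Suc m) (Suc m)" using jacobi_trudi_mat_carrier[of h lam] assms by simp
  have "jacobi_trudi h lam = (\<Sum>i<Suc m. ?A $$ (i, m) * cofactor ?A i m)"
    unfolding jacobi_trudi_def by (rule laplace_expansion_column[OF A]) simp
  also have "\<dots> = (\<Sum>i<Suc m. (-1) ^ (m - i) * h (lam ! i + (m - i)) *
    jacobi_trudi h (take i lam @ map (\<lambda>p. p - 1) (drop (Suc i) lam)))"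
  proof (rule sum.cong[OF refl])
    fix i assume "i \<in> {..<Suc m}"
    then have i: "i \<le> m" by simp
    let ?mu = "take i lam @ map (\<lambda>p. p - 1) (drop (Suc i) lam)"
    have len: "length ?mu = m" using assms i by simp
    have "mat_delete ?A i m = jacobi_trudi_mat h ?mu"
    proof (rule eq_matI)
      fix r c assume "r < dim_row (jacobi_trudi_mat h ?mu)" "c < dim_col (jacobi_trudi_mat h ?mu)"
      then have rc: "r < m" "c < m" using len by (auto simp: jacobi_trudi_mat_def)
      have pos: "lam ! Suc r \<ge> 1"
        using rc assms by (metis Suc_less_eq less_one linorder_not_less nth_mem)
      have "mat_delete ?A i m $$ (r, c) = ?A $$ (if r < i then r else Suc r, c)"
        using rc A by (auto simp: mat_delete_def)
      also have "\<dots> = jacobi_trudi_mat h ?mu $$ (r, c)"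
      proof (cases "r < i")
        case True
        then show ?thesis using rc assms i len by (simp add: jacobi_trudi_mat_nth nth_append)
      next
        case False
        then have "?mu ! r = lam ! Suc r - 1" using rc assms i by (simp add: nth_append)
        moreover have "int (lam ! Suc r - 1) + int c - int r = int (lam ! Suc r) + int c - int (Suc r)"
          using pos by simp
        ultimately show ?thesis using False rc assms(1) len
          by (simp only: jacobi_trudi_mat_nth if_False Suc_less_eq less_SucI)
      qed
      finally show "mat_delete ?A i m $$ (r, c) = jacobi_trudi_mat h ?mu $$ (r, c)" .
    qed (use A len in \<open>auto simp: mat_delete_def jacobi_trudi_mat_def\<close>)
    moreover have "?A $$ (i, m) = h (lam ! i + (m - i))"
    proof -
      have "int (lam ! i) + int m - int i = int (lam ! i + (m - i))" using i by (simp add: of_nat_diff)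
      then have "extend_by_0 h (int (lam ! i) + int m - int i) = h (lam ! i + (m - i))"
        by (simp only: extend_by_0_def nat_int) simp
      then show ?thesis using i assms by (simp add: jacobi_trudi_mat_nth)
    qed
    moreover have "(-1) ^ (i + m) = ((-1) ^ (m - i) :: 'a)"
      using i by (metis add_diff_inverse_nat linorder_not_less minus_one_power_iff even_add)
    ultimately show "?A $$ (i, m) * cofactor ?A i m =
        (-1) ^ (m - i) * h (lam ! i + (m - i)) * jacobi_trudi h ?mu"
      by (simp add: cofactor_def jacobi_trudi_def mult_ac)
  qed
  finally show ?thesis .
qed

text \<open>A pair of sequences with generating functions satisfying \<open>h(t) e(-t) = 1\<close>.\<close>

locale dual_sequences =
  fixes h e :: "nat \<Rightarrow> 'r::comm_ring_1"
  assumes h_0: "h 0 = 1" and e_0: "e 0 = 1"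
    and duality: "n > 0 \<Longrightarrow> (\<Sum>i\<le>n. (-1) ^ i * e i * h (n - i)) = 0"
begin

definition hook :: "nat \<Rightarrow> nat \<Rightarrow> 'r" where
  "hook a b = jacobi_trudi h (Suc a # replicate b 1)"

lemma hook_0: "hook a 0 = h (Suc a)"
  using jacobi_trudi_expand_last_column[of "[Suc a]" 0 h] by (simp add: hook_def jacobi_trudi_Nil)

text \<open>Removing row 0 leaves only zero parts; removing a later row cuts the column of the hook there.\<close>

lemma hook_recursion:
  "hook a b = (-1) ^ b * h (Suc a + b) + (\<Sum>i<b. (-1) ^ (b - 1 - i) * h (b - i) * hook a i)"
proof -
  have "hook a b = (\<Sum>i<Suc b. (-1) ^ (b - i) * h ((Suc a # replicate b 1) ! i + (b - i)) *
      jacobi_trudi h (take i (Suc a # replicate b 1) @ map (\<lambda>p. p - 1) (drop (Suc i) (Suc a # replicate b 1))))"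
    unfolding hook_def by (rule jacobi_trudi_expand_last_column) auto
  also have "\<dots> = (-1) ^ b * h (Suc a + b) + (\<Sum>i<b. (-1) ^ (b - 1 - i) * h (b - i) * hook a i)"
    using jacobi_trudi_append_zeros[of h "[]" b, OF h_0]
    by (subst sum.lessThan_Suc_shift, intro arg_cong2[where f = "(+)"] sum.cong)
      (auto simp: jacobi_trudi_Nil hook_def min_def h_0 Suc_diff_Suc jacobi_trudi_append_zeros simp del: append_Cons simp flip: append_Cons)
  finally show ?thesis .
qed

lemma sum_e_h_last:
  "(\<Sum>i<Suc n. (-1) ^ (n - i) * h (Suc n - i) * e i) = e (Suc n)"
proof -
  have "(-1) ^ (n - i) = ((-1) ^ n * (-1) ^ i :: 'r)" if "i \<le> n" for i
    using that by (simp add: minus_one_power_iff)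
  then have "(\<Sum>i<Suc n. (-1) ^ (n - i) * h (Suc n - i) * e i) =
      (-1) ^ n * (\<Sum>i<Suc n. (-1) ^ i * e i * h (Suc n - i))"
    unfolding sum_distrib_left by (intro sum.cong) (auto simp: mult_ac)
  also have "(\<Sum>i<Suc n. (-1) ^ i * e i * h (Suc n - i)) = - ((-1) ^ Suc n * e (Suc n))"
    using duality[of "Suc n"] by (simp add: h_0 eq_neg_iff_add_eq_0 lessThan_Suc_atMost)
  finally show ?thesis by (simp flip: mult.assoc power_add)
qed

text \<open>The expansions of the two hooks along the last column combine, by induction, into the expansion
  of \<open>e (Suc b)\<close> multiplied by \<open>h (Suc a)\<close>.\<close>

lemma hook_pieri: "hook a (Suc b) + hook (Suc a) b = h (Suc a) * e (Suc b)"
proof (induction b rule: less_induct)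
  case (less b)
  have IH: "hook a (Suc i) = h (Suc a) * e (Suc i) - hook (Suc a) i" if "i < b" for i
    using less[OF that] by (simp add: eq_diff_eq)
  have "hook a (Suc b) = (-1) ^ Suc b * h (Suc a + Suc b) +
      (\<Sum>i<Suc b. (-1) ^ (b - i) * h (Suc b - i) * hook a i)"
    by (subst hook_recursion) simp
  also have "(\<Sum>i<Suc b. (-1) ^ (b - i) * h (Suc b - i) * hook a i) =
      (-1) ^ b * h (Suc b) * (h (Suc a) * e 0) +
      (\<Sum>i<b. (-1) ^ (b - Suc i) * h (b - i) * (h (Suc a) * e (Suc i) - hook (Suc a) i))"
    by (subst sum.lessThan_Suc_shift) (simp add: hook_0 e_0 IH)
  also have "\<dots> = h (Suc a) * (\<Sum>i<Suc b. (-1) ^ (b - i) * h (Suc b - i) * e i) -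
      (\<Sum>i<b. (-1) ^ (b - 1 - i) * h (b - i) * hook (Suc a) i)"
    by (subst sum.lessThan_Suc_shift)
      (simp add: sum_distrib_left sum_subtractf algebra_simps)
  finally show ?case
    unfolding sum_e_h_last by (simp add: hook_recursion[of "Suc a" b] algebra_simps)
qed

definition two_columns :: "nat \<Rightarrow> nat \<Rightarrow> 'r" where
  "two_columns m k = jacobi_trudi h (replicate m 2 @ replicate k 1)"

text \<open>Removing a row of length 2 turns the later rows of length 2 into rows of length 1 and those of
  length 1 into rows of length 0.\<close>

lemma two_columns_recursion:
  assumes "m + k > 0"
  shows "two_columns m k =
    (\<Sum>i<m. (-1) ^ (m + k - 1 - i) * h (m + k + 1 - i) * two_columns i (m - 1 - i)) +
    (\<Sum>i<k. (-1) ^ (k - 1 - i) * h (k - i) * two_columns m i)"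
proof -
  let ?lam = "replicate m 2 @ replicate k (1::nat)"
  define t where "t i = (-1) ^ (m + k - 1 - i) * h (?lam ! i + (m + k - 1 - i)) *
      jacobi_trudi h (take i ?lam @ map (\<lambda>p. p - 1) (drop (Suc i) ?lam))" for i
  have "two_columns m k = (\<Sum>i<Suc (m + k - 1). t i)"
    unfolding two_columns_def t_def using assms by (intro jacobi_trudi_expand_last_column) auto
  also have "Suc (m + k - 1) = m + k" using assms by simp
  also have "(\<Sum>i<m + k. t i) = (\<Sum>i<m. t i) + (\<Sum>i<k. t (m + i))"
    by (induction k) (simp_all add: add_ac)
  also have "(\<Sum>i<m. t i) =
      (\<Sum>i<m. (-1) ^ (m + k - 1 - i) * h (m + k + 1 - i) * two_columns i (m - 1 - i))"
  proof (rule sum.cong[OF refl])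
    fix i assume "i \<in> {..<m}"
    then have i: "i < m" by simp
    have "take i ?lam @ map (\<lambda>p. p - 1) (drop (Suc i) ?lam) =
        (replicate i 2 @ replicate (m - 1 - i) 1) @ replicate k 0"
      using i by (simp add: min_def)
    then have "jacobi_trudi h (take i ?lam @ map (\<lambda>p. p - 1) (drop (Suc i) ?lam)) =
        two_columns i (m - 1 - i)"
      by (simp only: jacobi_trudi_append_zeros[of h, OF h_0] two_columns_def)
    moreover have "2 + (m + k - 1 - i) = m + k + 1 - i" "?lam ! i = 2"
      using i by (auto simp: nth_append)
    ultimately show "t i = (-1) ^ (m + k - 1 - i) * h (m + k + 1 - i) * two_columns i (m - 1 - i)"
      by (simp add: t_def)
  qed
  also have "(\<Sum>i<k. t (m + i)) = (\<Sum>i<k. (-1) ^ (k - 1 - i) * h (k - i) * two_columns m i)"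
  proof (rule sum.cong[OF refl])
    fix i assume "i \<in> {..<k}"
    then have i: "i < k" by simp
    have "take (m + i) ?lam @ map (\<lambda>p. p - 1) (drop (Suc (m + i)) ?lam) =
        (replicate m 2 @ replicate i 1) @ replicate (k - 1 - i) 0"
      using i by (simp add: min_def)
    then have "jacobi_trudi h (take (m + i) ?lam @ map (\<lambda>p. p - 1) (drop (Suc (m + i)) ?lam)) =
        two_columns m i"
      by (simp only: jacobi_trudi_append_zeros[of h, OF h_0] two_columns_def)
    moreover have "1 + (m + k - 1 - (m + i)) = k - i" "m + k - 1 - (m + i) = k - 1 - i"
      "?lam ! (m + i) = 1"
      using i by (auto simp: nth_append)
    ultimately show "t (m + i) = (-1) ^ (k - 1 - i) * h (k - i) * two_columns m i"
      by (simp add: t_def)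
  qed
  finally show ?thesis .
qed

lemma two_columns_0: "two_columns 0 k = e k"
proof (induction k rule: less_induct)
  case (less k)
  show ?case
  proof (cases k)
    case 0
    then show ?thesis by (simp add: two_columns_def jacobi_trudi_Nil e_0)
  next
    case (Suc n)
    then have "two_columns 0 k = (\<Sum>i<Suc n. (-1) ^ (n - i) * h (Suc n - i) * e i)"
      using less by (subst two_columns_recursion) simp_all
    then show ?thesis using Suc sum_e_h_last by simp
  qed
qed

text \<open>Substituting the induction hypothesis into the recursion yields two sums of terms
  \<open>e_j h_(N-j)\<close> and \<open>e_j h_(N+1-j)\<close>. Each runs over all \<open>j\<close>
  except one index in the middle and the last one, so duality expresses it by these two terms. The
  terms from the middle cancel.\<close>

lemma two_columns_Suc:
  "two_columns (Suc m) k = e (Suc m + k) * e (Suc m) - e (Suc (Suc m + k)) * e m"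
proof (induction "Suc m + k" arbitrary: m k rule: less_induct)
  case (less m k)
  let ?N = "Suc m + k"
  define s where "s = ((-1) ^ ?N :: 'r)"
  have sq: "s * s = 1" by (simp add: s_def flip: power_add)
  define f g where "f j = (-1) ^ j * e j * h (?N - j)" and "g j = (-1) ^ j * e j * h (Suc ?N - j)" for j
  have A: "(\<Sum>i<Suc m. (-1) ^ (?N - 1 - i) * h (?N + 1 - i) * two_columns i (m - i)) =
      - s * e m * (\<Sum>i<Suc m. g i) - s * e (Suc m) * (\<Sum>i<m. f i)"
  proof -
    have sg: "(-1) ^ (m + k - i) = (- s * (-1) ^ i :: 'r)" if "i \<le> m" for i
      using that by (simp add: s_def minus_one_power_iff)
    have "(-1) ^ (m + k - Suc i) * h (?N - i) * two_columns (Suc i) (m - Suc i) =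
        - s * e m * g (Suc i) - s * e (Suc m) * f i" if "i < m" for i
    proof -
      have IH: "two_columns (Suc i) (m - Suc i) = e m * e (Suc i) - e (Suc m) * e i"
        using less[of i "m - Suc i"] that by simp
      show ?thesis using that sg[of "Suc i"] unfolding IH
        by (simp add: f_def g_def algebra_simps)
    qed
    then have 1: "(\<Sum>i<m. (-1) ^ (m + k - Suc i) * h (?N - i) * two_columns (Suc i) (m - Suc i)) =
        - s * e m * (\<Sum>i<m. g (Suc i)) - s * e (Suc m) * (\<Sum>i<m. f i)"
      by (simp add: sum_subtractf sum_distrib_left sum_negf)
    have 2: "(-1) ^ (m + k) * h (?N + 1) * two_columns 0 m = - s * e m * g 0"
      using sg[of 0] by (simp add: g_def two_columns_0 e_0)
    have "(\<Sum>i<Suc m. (-1) ^ (?N - 1 - i) * h (?N + 1 - i) * two_columns i (m - i)) =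
        (-1) ^ (m + k) * h (?N + 1) * two_columns 0 m +
        (\<Sum>i<m. (-1) ^ (m + k - Suc i) * h (?N - i) * two_columns (Suc i) (m - Suc i))"
      by (subst sum.lessThan_Suc_shift) simp
    also have "\<dots> = - s * e m * (\<Sum>i<Suc m. g i) - s * e (Suc m) * (\<Sum>i<m. f i)"
      unfolding 1 2 sum.lessThan_Suc_shift[of g m] by (simp add: algebra_simps)
    finally show ?thesis .
  qed
  have B: "(\<Sum>i<k. (-1) ^ (k - 1 - i) * h (k - i) * two_columns (Suc m) i) =
      - s * e (Suc m) * (\<Sum>i<k. f (Suc m + i)) - s * e m * (\<Sum>i<k. g (Suc (Suc m) + i))"
  proof -
    have "(-1) ^ (k - 1 - i) * h (k - i) * two_columns (Suc m) i =
        - s * e (Suc m) * f (Suc m + i) - s * e m * g (Suc (Suc m) + i)" if "i < k" for i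
    proof -
      have IH: "two_columns (Suc m) i = e (Suc m + i) * e (Suc m) - e (Suc (Suc m + i)) * e m"
        using less[of m i] that by simp
      have sg: "(-1) ^ (k - 1 - i) = (- s * (-1) ^ (Suc m + i) :: 'r)"
        using that by (auto simp: s_def minus_one_power_iff)
      show ?thesis unfolding IH sg by (simp add: f_def g_def algebra_simps)
    qed
    then show ?thesis by (simp add: sum_subtractf sum_distrib_left sum_negf)
  qed
  \<comment> \<open>Duality in degrees \<open>?N\<close> and \<open>Suc ?N\<close>, with the indices that the recursion omits separated.\<close>
  have split_f: "(\<Sum>i<m. f i) + f m + (\<Sum>i<k. f (Suc m + i)) + f ?N = 0"
  proof -
    have "(\<Sum>i\<le>?N. f i) = 0" unfolding f_def by (rule duality) simp
    moreover have "(\<Sum>i\<le>Suc m + k. f i) = (\<Sum>i<m. f i) + f m + (\<Sum>i<k. f (Suc m + i)) + f (Suc m + k)"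
      by (induction k) (simp_all add: add_ac flip: lessThan_Suc_atMost)
    ultimately show ?thesis by simp
  qed
  have split_g: "(\<Sum>i<Suc m. g i) + g (Suc m) + (\<Sum>i<k. g (Suc (Suc m) + i)) + g (Suc ?N) = 0"
  proof -
    have "(\<Sum>i\<le>Suc ?N. g i) = 0" unfolding g_def by (rule duality) simp
    moreover have "(\<Sum>i\<le>Suc (Suc m + k). g i) =
        (\<Sum>i<Suc m. g i) + g (Suc m) + (\<Sum>i<k. g (Suc (Suc m) + i)) + g (Suc (Suc m + k))"
      by (induction k) (simp_all add: add_ac flip: lessThan_Suc_atMost)
    ultimately show ?thesis by simp
  qed
  have "two_columns (Suc m) k = - s * e m * (\<Sum>i<Suc m. g i) - s * e (Suc m) * (\<Sum>i<m. f i) +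
      (- s * e (Suc m) * (\<Sum>i<k. f (Suc m + i)) - s * e m * (\<Sum>i<k. g (Suc (Suc m) + i)))"
    unfolding A[symmetric] B[symmetric] by (subst two_columns_recursion) simp_all
  also have "\<dots> = - s * e (Suc m) * ((\<Sum>i<m. f i) + (\<Sum>i<k. f (Suc m + i)))
      - s * e m * ((\<Sum>i<Suc m. g i) + (\<Sum>i<k. g (Suc (Suc m) + i)))"
    by (simp add: algebra_simps)
  also have "(\<Sum>i<m. f i) + (\<Sum>i<k. f (Suc m + i)) = - f m - f ?N"
    using split_f by (simp add: algebra_simps eq_neg_iff_add_eq_0)
  also have "(\<Sum>i<Suc m. g i) + (\<Sum>i<k. g (Suc (Suc m) + i)) = - g (Suc m) - g (Suc ?N)"
    using split_g by (simp add: algebra_simps eq_neg_iff_add_eq_0)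
  also have "f ?N = s * e ?N" by (simp add: f_def s_def h_0)
  also have "g (Suc ?N) = - s * e (Suc ?N)" by (simp add: g_def s_def h_0)
  also have "g (Suc m) = - ((-1) ^ m * e (Suc m) * h (Suc k))" by (simp add: g_def)
  also have "f m = (-1) ^ m * e m * h (Suc k)" by (simp add: f_def)
  also have "- s * e (Suc m) * (- ((-1) ^ m * e m * h (Suc k)) - s * e ?N) -
      s * e m * (- (- ((-1) ^ m * e (Suc m) * h (Suc k))) - - s * e (Suc ?N)) =
      (s * s) * (e ?N * e (Suc m) - e (Suc ?N) * e m)"
    by (simp add: algebra_simps)
  finally show ?case by (simp add: sq)
qed

end

section \<open>Counting multisets with bosonic and fermionic letters\<close>

text \<open>Odd letters are those of an exterior power: they may be used at most once, and contribute to
  Newton's identity with alternating signs.\<close>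

locale super_alphabet =
  fixes V :: "'v set" and odd_letter :: "'v \<Rightarrow> bool"
begin

definition super_msets :: "'v multiset set" where
  "super_msets = {M. set_mset M \<subseteq> V \<and> (\<forall>v. odd_letter v \<longrightarrow> count M v \<le> 1)}"

definition letter_sign :: "'v \<Rightarrow> int" where
  "letter_sign v = (if odd_letter v then -1 else 1)"

lemma bij_betw_remove_copies:
  assumes "v \<in> V" "\<not> odd_letter v"
  shows "bij_betw (\<lambda>M. M + replicate_mset k v)
    {M \<in> super_msets. M + replicate_mset k v \<in> L} {M \<in> super_msets \<inter> L. k \<le> count M v}"
proof (rule bij_betwI[where g = "\<lambda>M. M - replicate_mset k v"])
  show "(\<lambda>M. M + replicate_mset k v) \<in> {M \<in> super_msets. M + replicate_mset k v \<in> L} \<rightarrow>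
      {M \<in> super_msets \<inter> L. k \<le> count M v}"
    using assms by (auto simp: super_msets_def in_replicate_mset split: if_splits)
  show "(\<lambda>M. M - replicate_mset k v) \<in> {M \<in> super_msets \<inter> L. k \<le> count M v} \<rightarrow>
      {M \<in> super_msets. M + replicate_mset k v \<in> L}"
  proof
    fix M assume "M \<in> {M \<in> super_msets \<inter> L. k \<le> count M v}"
    then have M: "M \<in> super_msets" "M \<in> L" "replicate_mset k v \<subseteq># M"
      by (auto simp: count_le_replicate_mset_subset_eq)
    have "M - replicate_mset k v \<in> super_msets"
      using M(1) by (auto simp: super_msets_def dest: in_diffD)
    then show "M - replicate_mset k v \<in> {M \<in> super_msets. M + replicate_mset k v \<in> L}"
      using M by simp
  qed
  show "M - replicate_mset k v + replicate_mset k v = M"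
    if "M \<in> {M \<in> super_msets \<inter> L. k \<le> count M v}" for M
    using that by (simp add: count_le_replicate_mset_subset_eq)
qed simp

text \<open>An even letter of multiplicity \<open>m\<close> is counted once for every
  \<open>k \<le> m\<close>, through the multiset with \<open>k\<close> copies removed.\<close>

lemma sum_count_even_letter:
  assumes "v \<in> V" "\<not> odd_letter v" and fin: "finite L"
    and bound: "\<And>M. M \<in> L \<Longrightarrow> size M \<le> n"
  shows "(\<Sum>M\<in>super_msets \<inter> L. count M v) =
    (\<Sum>k=1..n. card {M \<in> super_msets. M + replicate_mset k v \<in> L})"
proof -
  have "(\<Sum>M\<in>super_msets \<inter> L. count M v) =
      (\<Sum>M\<in>super_msets \<inter> L. \<Sum>k=1..n. if k \<le> count M v then 1 else 0)"
  proof (rule sum.cong[OF refl])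
    fix M assume "M \<in> super_msets \<inter> L"
    then have "count M v \<le> n" using bound[of M] count_le_size[of M v] by simp
    then have "{1..n} \<inter> {k. k \<le> count M v} = {1..count M v}" by auto
    then show "count M v = (\<Sum>k=1..n. if k \<le> count M v then 1 else 0)"
      by (simp add: sum.If_cases)
  qed
  also have "\<dots> = (\<Sum>k=1..n. \<Sum>M\<in>super_msets \<inter> L. if k \<le> count M v then 1 else 0)"
    by (rule sum.swap)
  also have "\<dots> = (\<Sum>k=1..n. card {M \<in> super_msets \<inter> L. k \<le> count M v})"
    using fin by (intro sum.cong refl) (simp add: sum.If_cases Int_def)
  also have "\<dots> = (\<Sum>k=1..n. card {M \<in> super_msets. M + replicate_mset k v \<in> L})"
    using bij_betw_same_card[OF bij_betw_remove_copies[OF assms(1,2)]] by simp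
  finally show ?thesis .
qed

lemma bij_betw_remove_one:
  assumes "v \<in> V" "odd_letter v"
  shows "bij_betw (add_mset v)
    {M \<in> super_msets. v \<notin># M \<and> add_mset v M \<in> L} {M \<in> super_msets \<inter> L. v \<in># M}"
proof (rule bij_betwI[where g = "\<lambda>M. M - {#v#}"])
  show "add_mset v \<in> {M \<in> super_msets. v \<notin># M \<and> add_mset v M \<in> L} \<rightarrow>
      {M \<in> super_msets \<inter> L. v \<in># M}"
    using assms by (auto simp: super_msets_def not_in_iff)
  show "(\<lambda>M. M - {#v#}) \<in> {M \<in> super_msets \<inter> L. v \<in># M} \<rightarrow>
      {M \<in> super_msets. v \<notin># M \<and> add_mset v M \<in> L}"
  proof
    fix M assume "M \<in> {M \<in> super_msets \<inter> L. v \<in># M}"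
    then have M: "M \<in> super_msets" "M \<in> L" "v \<in># M" by auto
    then have "count M v \<le> 1" using assms by (simp add: super_msets_def)
    then have "v \<notin># M - {#v#}" by (simp add: not_in_iff)
    moreover have "M - {#v#} \<in> super_msets"
      using M(1) by (auto simp: super_msets_def dest: in_diffD intro: le_trans[OF diff_le_self])
    ultimately show "M - {#v#} \<in> {M \<in> super_msets. v \<notin># M \<and> add_mset v M \<in> L}"
      using M by simp
  qed
qed (auto simp: not_in_iff)

text \<open>Let \<open>U k\<close> consist of the multisets without \<open>v\<close> that land in
  \<open>L\<close> when \<open>k\<close> copies of \<open>v\<close> are added. Sorting by whether
  \<open>v\<close> occurs, the \<open>k\<close>-th term is
  \<open>card (U k) + card (U (Suc k))\<close>, and the alternating sum telescopes to
  \<open>card (U 1)\<close>.\<close>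

lemma sum_count_odd_letter:
  assumes "v \<in> V" "odd_letter v" and fin: "finite L"
    and bound: "\<And>M. M \<in> L \<Longrightarrow> size M \<le> n"
  shows "int (\<Sum>M\<in>super_msets \<inter> L. count M v) =
    (\<Sum>k=1..n. (-1) ^ (k - 1) * int (card {M \<in> super_msets. M + replicate_mset k v \<in> L}))"
proof -
  define U where "U k = {M \<in> super_msets. v \<notin># M \<and> M + replicate_mset k v \<in> L}" for k
  have split: "card {M \<in> super_msets. M + replicate_mset k v \<in> L} = card (U k) + card (U (Suc k))" for k
  proof -
    let ?L = "{M. M + replicate_mset k v \<in> L}"
    have U: "U (Suc k) = {M \<in> super_msets. v \<notin># M \<and> add_mset v M \<in> ?L}"
      by (simp add: U_def)
    have "finite ?L"
      using finite_vimageI[OF fin, of "\<lambda>M. M + replicate_mset k v"] by (simp add: vimage_def inj_on_def)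
    then have "card (super_msets \<inter> ?L) =
        card {M \<in> super_msets \<inter> ?L. v \<notin># M} + card {M \<in> super_msets \<inter> ?L. v \<in># M}"
      by (subst card_Un_disjoint[symmetric]) (auto intro!: arg_cong[where f = card])
    also have "{M \<in> super_msets \<inter> ?L. v \<notin># M} = U k" by (auto simp: U_def)
    also have "card {M \<in> super_msets \<inter> ?L. v \<in># M} = card (U (Suc k))"
      unfolding U by (rule bij_betw_same_card[symmetric, OF bij_betw_remove_one[OF assms(1,2)]])
    finally show ?thesis by (simp add: Int_def)
  qed
  have "(\<Sum>k=1..m. (-1) ^ (k - 1) * int (card (U k) + card (U (Suc k)))) =
      int (card (U 1)) - (-1) ^ m * int (card (U (Suc m)))" for m
    by (induction m) (simp_all add: algebra_simps)
  moreover have "U (Suc n) = {}" using bound by (fastforce simp: U_def)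
  moreover have "(\<Sum>M\<in>super_msets \<inter> L. count M v) = card (U 1)"
  proof -
    have "(\<Sum>M\<in>super_msets \<inter> L. count M v) = (\<Sum>M\<in>super_msets \<inter> L. if v \<in># M then 1 else 0)"
    proof (rule sum.cong[OF refl])
      fix M assume "M \<in> super_msets \<inter> L"
      then have "count M v \<le> 1" using assms(2) by (simp add: super_msets_def)
      then show "count M v = (if v \<in># M then 1 else 0)"
        by (auto simp: not_in_iff simp flip: count_greater_zero_iff)
    qed
    also have "\<dots> = card {M \<in> super_msets \<inter> L. v \<in># M}"
      using fin by (simp add: sum.If_cases Int_def)
    also have "\<dots> = card {M \<in> super_msets. v \<notin># M \<and> add_mset v M \<in> L}"
      by (rule bij_betw_same_card[symmetric, OF bij_betw_remove_one[OF assms(1,2)]])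
    finally show ?thesis by (simp add: U_def)
  qed
  ultimately show ?thesis by (simp add: split)
qed

end

text \<open>The flag says whether the power is exterior. One vector \<open>(i, j)\<close> is attached to
  each point of the permutation representation: the exponents of this point in the two powers.\<close>

definition letters :: "bool \<Rightarrow> nat set" where
  "letters s = (if s then {0, 1} else UNIV)"

definition sign_of :: "bool \<Rightarrow> nat \<Rightarrow> int" where
  "sign_of s i = (if s \<and> i = 1 then -1 else 1)"

text \<open>Two exterior letters at the same point commute past another such pair, so \<open>(1, 1)\<close>
  is even for two exterior powers.\<close>

definition odd_vector :: "bool \<Rightarrow> bool \<Rightarrow> nat \<times> nat \<Rightarrow> bool" where
  "odd_vector s t v \<longleftrightarrow> (s \<and> fst v = 1) \<noteq> (t \<and> snd v = 1)"

interpretation vec: super_alphabet "letters s \<times> letters t" "odd_vector s t" for s t .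

lemma letter_sign_vector: "vec.letter_sign s t (i, j) = sign_of s i * sign_of t j"
  by (auto simp: vec.letter_sign_def odd_vector_def sign_of_def)

definition arrangements :: "bool \<Rightarrow> bool \<Rightarrow> nat \<Rightarrow> nat \<Rightarrow> nat \<Rightarrow> nat" where
  "arrangements s t n a b = card {M \<in> vec.super_msets s t. size M = n \<and> \<Sum>\<^sub># M = (a, b)}"

lemma fst_sum_mset: "fst (\<Sum>\<^sub># M) = (\<Sum>v\<in>#M. fst v)"
  by (induction M) auto

lemma snd_sum_mset: "snd (\<Sum>\<^sub># M) = (\<Sum>v\<in>#M. snd v)"
  by (induction M) auto

lemma vector_le_sum:
  fixes M :: "(nat \<times> nat) multiset"
  assumes "v \<in># M" "\<Sum>\<^sub># M = (a, b)"
  shows "fst v \<le> a" "snd v \<le> b"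
proof -
  obtain N where "M = add_mset v N" using assms(1) by (metis insert_DiffM)
  then have "v + \<Sum>\<^sub># N = (a, b)" using assms(2) by simp
  then show "fst v \<le> a" "snd v \<le> b" by (cases v; cases "\<Sum>\<^sub># N"; simp)+
qed

lemma finite_msets_sum: "finite {M :: (nat \<times> nat) multiset. size M = n \<and> \<Sum>\<^sub># M = (a, b)}"
proof (rule finite_subset)
  show "finite (multisets_of_size ({..a} \<times> {..b}) n)" by auto
  show "{M :: (nat \<times> nat) multiset. size M = n \<and> \<Sum>\<^sub># M = (a, b)} \<subseteq> multisets_of_size ({..a} \<times> {..b}) n"
    by (auto simp: multisets_of_size_def dest: vector_le_sum)
qed

lemma sum_mset_replicate_vector: "\<Sum>\<^sub># (replicate_mset k (i, j)) = (k * i, k * j :: nat)"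
  by (induction k) (auto simp: zero_prod_def)

lemma card_remove_copies:
  assumes "k \<le> n"
  shows "card {M \<in> vec.super_msets s t. M + replicate_mset k (i, j) \<in> {M. size M = n \<and> \<Sum>\<^sub># M = (a, b)}} =
    (if k * i \<le> a \<and> k * j \<le> b then arrangements s t (n - k) (a - k * i) (b - k * j) else 0)"
proof -
  have "{M \<in> vec.super_msets s t. M + replicate_mset k (i, j) \<in> {M. size M = n \<and> \<Sum>\<^sub># M = (a, b)}} =
      (if k * i \<le> a \<and> k * j \<le> b
       then {M \<in> vec.super_msets s t. size M = n - k \<and> \<Sum>\<^sub># M = (a - k * i, b - k * j)} else {})"
    using assms by (auto simp: sum_mset_replicate_vector prod_eq_iff)
  then show ?thesis by (simp add: arrangements_def)
qed

text \<open>Counting the elements of all multisets with multiplicity, letter by letter.\<close>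

lemma arrangements_newton:
  "int n * int (arrangements s t n a b) =
    (\<Sum>k=1..n. \<Sum>i\<in>letters s \<inter> {..a}. \<Sum>j\<in>letters t \<inter> {..b}. if k * i \<le> a \<and> k * j \<le> b
      then (sign_of s i * sign_of t j) ^ (k - 1) * int (arrangements s t (n - k) (a - k * i) (b - k * j)) else 0)"
proof -
  let ?L = "{M :: (nat \<times> nat) multiset. size M = n \<and> \<Sum>\<^sub># M = (a, b)}"
  let ?S = "vec.super_msets s t \<inter> ?L"
  let ?B = "(letters s \<inter> {..a}) \<times> (letters t \<inter> {..b})"
  have finL: "finite ?L" by (rule finite_msets_sum)
  have S: "?S = {M \<in> vec.super_msets s t. size M = n \<and> \<Sum>\<^sub># M = (a, b)}" by auto
  have "n * arrangements s t n a b = (\<Sum>M\<in>?S. n)"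
    unfolding arrangements_def S by simp
  also have "\<dots> = (\<Sum>M\<in>?S. \<Sum>v\<in>?B. count M v)"
  proof (rule sum.cong[OF refl])
    fix M assume M: "M \<in> ?S"
    then have "set_mset M \<subseteq> ?B"
      using vector_le_sum[of _ M a b] by (fastforce simp: vec.super_msets_def)
    then have "(\<Sum>v\<in>?B. count M v) = (\<Sum>v\<in>set_mset M. count M v)"
      by (intro sum.mono_neutral_right) (auto simp: not_in_iff)
    then show "n = (\<Sum>v\<in>?B. count M v)" using M by (simp add: size_multiset_overloaded_eq)
  qed
  also have "\<dots> = (\<Sum>v\<in>?B. \<Sum>M\<in>?S. count M v)" by (rule sum.swap)
  finally have "int n * int (arrangements s t n a b) = (\<Sum>v\<in>?B. int (\<Sum>M\<in>?S. count M v))"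
    by (simp flip: of_nat_mult)
  also have "\<dots> = (\<Sum>v\<in>?B. \<Sum>k=1..n. vec.letter_sign s t v ^ (k - 1) *
      int (card {M \<in> vec.super_msets s t. M + replicate_mset k v \<in> ?L}))"
  proof (rule sum.cong[OF refl])
    fix v assume "v \<in> ?B"
    then have v: "v \<in> letters s \<times> letters t" by auto
    show "int (\<Sum>M\<in>?S. count M v) = (\<Sum>k=1..n. vec.letter_sign s t v ^ (k - 1) *
        int (card {M \<in> vec.super_msets s t. M + replicate_mset k v \<in> ?L}))"
    proof (cases "odd_vector s t v")
      case True
      then show ?thesis
        using vec.sum_count_odd_letter[OF v True finL, of n] by (simp add: vec.letter_sign_def)
    next
      case False
      then show ?thesis
        using vec.sum_count_even_letter[OF v False finL, of n] by (simp add: vec.letter_sign_def)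
    qed
  qed
  also have "\<dots> = (\<Sum>k=1..n. \<Sum>v\<in>?B. vec.letter_sign s t v ^ (k - 1) *
      int (card {M \<in> vec.super_msets s t. M + replicate_mset k v \<in> ?L}))"
    by (rule sum.swap)
  also have "\<dots> = (\<Sum>k=1..n. \<Sum>i\<in>letters s \<inter> {..a}. \<Sum>j\<in>letters t \<inter> {..b}. if k * i \<le> a \<and> k * j \<le> b
      then (sign_of s i * sign_of t j) ^ (k - 1) * int (arrangements s t (n - k) (a - k * i) (b - k * j)) else 0)"
  proof (rule sum.cong[OF refl])
    fix k assume "k \<in> {1..n}"
    then have "k \<le> n" by simp
    then have "vec.letter_sign s t (i, j) ^ (k - 1) *
        int (card {M \<in> vec.super_msets s t. M + replicate_mset k (i, j) \<in> ?L}) =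
        (if k * i \<le> a \<and> k * j \<le> b then (sign_of s i * sign_of t j) ^ (k - 1) *
          int (arrangements s t (n - k) (a - k * i) (b - k * j)) else 0)" for i j
      by (simp only: card_remove_copies letter_sign_vector) auto
    then show "(\<Sum>v\<in>?B. vec.letter_sign s t v ^ (k - 1) *
        int (card {M \<in> vec.super_msets s t. M + replicate_mset k v \<in> ?L})) =
      (\<Sum>i\<in>letters s \<inter> {..a}. \<Sum>j\<in>letters t \<inter> {..b}. if k * i \<le> a \<and> k * j \<le> b
        then (sign_of s i * sign_of t j) ^ (k - 1) * int (arrangements s t (n - k) (a - k * i) (b - k * j)) else 0)"
      unfolding sum.cartesian_product by (intro sum.cong refl) (simp only: split_paired_all prod.case)
  qed
  finally show ?thesis .
qed

text \<open>For a symmetric power this is \<open>1 / (1 - t^k)\<close>, for an exterior power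
  \<open>1 - (-t)^k\<close>.\<close>

definition power_sum :: "bool \<Rightarrow> nat \<Rightarrow> 'a::field_char_0 fps" where
  "power_sum s k = Abs_fps (\<lambda>i. if k dvd i \<and> i div k \<in> letters s
     then of_int (sign_of s (i div k)) ^ (k - 1) else 0)"

lemma sum_power_sum:
  assumes "k > 0"
  shows "(\<Sum>i=0..a. fps_nth (power_sum s k) i * F i) =
    (\<Sum>i\<in>letters s \<inter> {..a}. if k * i \<le> a then of_int (sign_of s i) ^ (k - 1) * F (k * i) else 0)"
proof -
  have "(\<Sum>i=0..a. fps_nth (power_sum s k) i * F i) =
      (\<Sum>i | i \<le> a \<and> k dvd i \<and> i div k \<in> letters s. of_int (sign_of s (i div k)) ^ (k - 1) * F i)"
    by (intro sum.mono_neutral_cong_right) (auto simp: power_sum_def)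
  also have "\<dots> = (\<Sum>i | i \<in> letters s \<and> k * i \<le> a. of_int (sign_of s i) ^ (k - 1) * F (k * i))"
    using assms by (intro sum.reindex_bij_witness[of _ "\<lambda>i. k * i" "\<lambda>i. i div k"]) auto
  also have "\<dots> = (\<Sum>i\<in>letters s \<inter> {..a}. if k * i \<le> a then of_int (sign_of s i) ^ (k - 1) * F (k * i) else 0)"
  proof -
    have "i \<le> a" if "k * i \<le> a" for i
      using that assms by (metis le_trans mult_le_mono1 mult_1 Suc_leI One_nat_def)
    then show ?thesis by (intro sum.mono_neutral_cong_left) auto
  qed
  finally show ?thesis .
qed

text \<open>\<open>P(x) Q(y)\<close> as a power series in \<open>y\<close> with coefficients in power series
  in \<open>x\<close>.\<close>

definition tensor :: "'a::comm_ring_1 fps \<Rightarrow> 'a fps \<Rightarrow> 'a fps fps" where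
  "tensor P Q = Abs_fps (\<lambda>j. Abs_fps (\<lambda>i. fps_nth P i * fps_nth Q j))"

lemma tensor_nth: "fps_nth (fps_nth (tensor P Q) j) i = fps_nth P i * fps_nth Q j"
  by (simp add: tensor_def)

lemma tensor_mult: "tensor P Q * tensor P' Q' = tensor (P * P') (Q * Q')"
proof (intro fps_ext)
  fix j i
  have "fps_nth (fps_nth (tensor P Q * tensor P' Q') j) i =
      (\<Sum>r=0..j. \<Sum>q=0..i. (fps_nth P q * fps_nth P' (i - q)) * (fps_nth Q r * fps_nth Q' (j - r)))"
    by (simp add: fps_mult_nth fps_sum_nth tensor_nth mult_ac)
  also have "\<dots> = fps_nth (fps_nth (tensor (P * P') (Q * Q')) j) i"
    by (simp add: tensor_nth fps_mult_nth sum_product sum.swap[of _ "{0..i}"])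
  finally show "fps_nth (fps_nth (tensor P Q * tensor P' Q') j) i =
      fps_nth (fps_nth (tensor (P * P') (Q * Q')) j) i" .
qed

lemma tensor_1: "tensor 1 1 = 1"
  by (intro fps_ext) (simp add: tensor_nth)

lemma tensor_prod: "(\<Prod>x\<in>X. tensor (P x) (Q x)) = tensor (\<Prod>x\<in>X. P x) (\<Prod>x\<in>X. Q x)"
  by (induction X rule: infinite_finite_induct) (simp_all add: tensor_1 tensor_mult)

definition arrangement_series :: "bool \<Rightarrow> bool \<Rightarrow> nat \<Rightarrow> 'a::field_char_0 fps fps" where
  "arrangement_series s t n = Abs_fps (\<lambda>b. Abs_fps (\<lambda>a. of_nat (arrangements s t n a b)))"

lemma arrangement_series_newton:
  "of_nat n * arrangement_series s t n =
    (\<Sum>k=1..n. tensor (power_sum s k) (power_sum t k) * arrangement_series s t (n - k) :: 'a::field_char_0 fps fps)"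
proof (intro fps_ext)
  fix b a
  let ?c = "\<lambda>k i j. of_nat (arrangements s t (n - k) (a - i) (b - j)) :: 'a"
  have "fps_nth (fps_nth (tensor (power_sum s k) (power_sum t k) * arrangement_series s t (n - k) :: 'a fps fps) b) a =
      (\<Sum>i\<in>letters s \<inter> {..a}. \<Sum>j\<in>letters t \<inter> {..b}. if k * i \<le> a \<and> k * j \<le> b
        then of_int ((sign_of s i * sign_of t j) ^ (k - 1) *
          int (arrangements s t (n - k) (a - k * i) (b - k * j))) else 0)" if "k \<in> {1..n}" for k
  proof -
    have k: "k > 0" using that by simp
    have "fps_nth (fps_nth (tensor (power_sum s k) (power_sum t k) * arrangement_series s t (n - k) :: 'a fps fps) b) a =
        (\<Sum>j=0..b. \<Sum>i=0..a. fps_nth (power_sum s k) i * fps_nth (power_sum t k) j * ?c k i j)"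
      by (simp add: fps_mult_nth fps_sum_nth tensor_nth arrangement_series_def)
    also have "\<dots> = (\<Sum>i=0..a. fps_nth (power_sum s k) i * (\<Sum>j=0..b. fps_nth (power_sum t k) j * ?c k i j))"
      by (subst sum.swap) (simp add: sum_distrib_left mult.assoc)
    also have "\<dots> = (\<Sum>i\<in>letters s \<inter> {..a}. if k * i \<le> a then of_int (sign_of s i) ^ (k - 1) *
        (\<Sum>j\<in>letters t \<inter> {..b}. if k * j \<le> b then of_int (sign_of t j) ^ (k - 1) * ?c k (k * i) (k * j) else 0) else 0)"
      by (simp only: sum_power_sum[OF k])
    also have "\<dots> = (\<Sum>i\<in>letters s \<inter> {..a}. \<Sum>j\<in>letters t \<inter> {..b}. if k * i \<le> a \<and> k * j \<le> b
        then of_int ((sign_of s i * sign_of t j) ^ (k - 1) *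
          int (arrangements s t (n - k) (a - k * i) (b - k * j))) else 0)"
      by (intro sum.cong refl) (auto simp: sum_distrib_left power_mult_distrib mult.assoc intro!: sum.cong)
    finally show ?thesis .
  qed
  then have "fps_nth (fps_nth (\<Sum>k=1..n. tensor (power_sum s k) (power_sum t k) * arrangement_series s t (n - k) :: 'a fps fps) b) a =
      of_int (\<Sum>k=1..n. \<Sum>i\<in>letters s \<inter> {..a}. \<Sum>j\<in>letters t \<inter> {..b}. if k * i \<le> a \<and> k * j \<le> b
      then (sign_of s i * sign_of t j) ^ (k - 1) * int (arrangements s t (n - k) (a - k * i) (b - k * j)) else 0)"
    by (simp add: fps_sum_nth if_distrib[of of_int] cong: if_cong)
  also have "\<dots> = of_nat n * of_nat (arrangements s t n a b)"
    unfolding arrangements_newton[symmetric] by simp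
  also have "\<dots> = fps_nth (fps_nth (of_nat n * arrangement_series s t n) b) a"
  proof -
    have "of_nat n = (fps_const (fps_const (of_nat n)) :: 'a fps fps)"
      by (simp add: fps_of_nat)
    then show ?thesis by (simp add: arrangement_series_def)
  qed
  finally show "fps_nth (fps_nth (of_nat n * arrangement_series s t n) b) a =
    fps_nth (fps_nth (\<Sum>k=1..n. tensor (power_sum s k) (power_sum t k) * arrangement_series s t (n - k) :: 'a fps fps) b) a"
    by simp
qed

lemma arrangement_series_0: "arrangement_series s t 0 = 1"
proof -
  have "{M \<in> vec.super_msets s t. size M = 0 \<and> \<Sum>\<^sub># M = (a, b)} = (if a = 0 \<and> b = 0 then {{#}} else {})" for a b
    by (auto simp: vec.super_msets_def zero_prod_def)
  then have "arrangements s t 0 a b = (if a = 0 \<and> b = 0 then 1 else 0)" for a b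
    by (simp add: arrangements_def)
  then show ?thesis
    by (intro fps_ext) (auto simp: arrangement_series_def)
qed

section \<open>Moments of products of two characters\<close>

lemma power_sum_False:
  assumes "k > 0"
  shows "power_sum False k = inverse (1 - fps_X ^ k)"
proof -
  have "(1 - fps_X ^ k) * power_sum False k = (1 :: 'a fps)"
  proof (rule fps_ext)
    fix i
    have "k dvd i \<longleftrightarrow> k dvd (i - k)" if "k \<le> i"
      using that by (simp add: dvd_minus_self)
    moreover have "k dvd i \<longleftrightarrow> i = 0" if "i < k"
      using that by (metis dvd_0_right dvd_imp_le neq0_conv not_le)
    ultimately show "fps_nth ((1 - fps_X ^ k) * power_sum False k) i = fps_nth (1 :: 'a fps) i"
      using assms by (auto simp: left_diff_distrib fps_X_power_mult_nth power_sum_def letters_def sign_of_def)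
  qed
  then show ?thesis by (metis fps_inverse_unique mult.commute)
qed

text \<open>The substitution of \<open>-t\<close> for \<open>t\<close>.\<close>

definition alternate_signs :: "'a::comm_ring_1 fps \<Rightarrow> 'a fps" where
  "alternate_signs P = Abs_fps (\<lambda>i. (-1) ^ i * fps_nth P i)"

lemma alternate_signs_mult: "alternate_signs (P * Q) = alternate_signs P * alternate_signs Q"
proof (rule fps_ext)
  fix n
  have "(-1) ^ n = ((-1) ^ i * (-1) ^ (n - i) :: 'a)" if "i \<le> n" for i
    using that by (simp flip: power_add)
  then show "fps_nth (alternate_signs (P * Q)) n = fps_nth (alternate_signs P * alternate_signs Q) n"
    by (auto simp: alternate_signs_def fps_mult_nth sum_distrib_left mult_ac intro!: sum.cong)
qed

lemma alternate_signs_1: "alternate_signs 1 = 1"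
  by (rule fps_ext) (simp add: alternate_signs_def)

lemma alternate_signs_power_sum_True:
  assumes "k > 0"
  shows "alternate_signs (power_sum True k) = (1 - fps_X ^ k :: 'a::field_char_0 fps)"
proof (rule fps_ext)
  fix i
  have "i div k \<in> {0, 1} \<and> k dvd i \<longleftrightarrow> i = 0 \<or> i = k"
    using assms by (auto elim!: dvdE)
  moreover have "(-1) ^ k * (-1) ^ (k - Suc 0) = (-1 :: 'a)"
    using assms by (cases k) (auto simp flip: power_add)
  ultimately show "fps_nth (alternate_signs (power_sum True k)) i = fps_nth (1 - fps_X ^ k :: 'a fps) i"
    using assms by (auto simp: alternate_signs_def power_sum_def letters_def sign_of_def)
qed

definition cycle_series :: "bool \<Rightarrow> 'b set set \<Rightarrow> 'a::field_char_0 fps" where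
  "cycle_series s Cs = (\<Prod>C\<in>Cs. power_sum s (card C))"

lemma cycle_series_False:
  assumes "\<And>C. C \<in> Cs \<Longrightarrow> card C > 0"
  shows "cycle_series False Cs = complete_series Cs"
  unfolding cycle_series_def complete_series_def
  by (intro prod.cong refl power_sum_False assms)

lemma cycle_series_duality:
  assumes "\<And>C. C \<in> Cs \<Longrightarrow> card C > 0"
  shows "alternate_signs (cycle_series True Cs) * cycle_series False Cs = (1 :: 'a::field_char_0 fps)"
proof -
  have "alternate_signs (cycle_series True Cs) = (\<Prod>C\<in>Cs. alternate_signs (power_sum True (card C)) :: 'a fps)"
    unfolding cycle_series_def
    by (induction Cs rule: infinite_finite_induct) (simp_all add: alternate_signs_1 alternate_signs_mult)
  also have "\<dots> * cycle_series False Cs = (\<Prod>C\<in>Cs. (1 - fps_X ^ card C :: 'a fps) * inverse (1 - fps_X ^ card C))"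
    unfolding cycle_series_def prod.distrib[symmetric]
    by (intro prod.cong refl) (simp add: assms alternate_signs_power_sum_True power_sum_False)
  also have "\<dots> = (\<Prod>C\<in>Cs. 1)"
  proof (rule prod.cong[OF refl])
    fix C assume "C \<in> Cs"
    then have "fps_nth (1 - fps_X ^ card C :: 'a fps) 0 \<noteq> 0" using assms by simp
    then show "(1 - fps_X ^ card C) * inverse (1 - fps_X ^ card C) = (1 :: 'a fps)"
      by (rule inverse_mult_eq_1')
  qed
  finally show ?thesis by simp
qed

lemma dual_sequences_cycle_series:
  assumes "\<And>C. C \<in> Cs \<Longrightarrow> card C > 0"
  shows "dual_sequences (fps_nth (cycle_series False Cs)) (fps_nth (cycle_series True Cs :: 'a::field_char_0 fps))"
proof
  have ps0: "fps_nth (power_sum s k :: 'a fps) 0 = 1" for s k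
    by (simp add: power_sum_def letters_def sign_of_def)
  have "fps_nth (cycle_series s Cs :: 'a fps) 0 = 1" for s
    unfolding cycle_series_def by (induction Cs rule: infinite_finite_induct) (simp_all add: ps0)
  then show "fps_nth (cycle_series False Cs :: 'a fps) 0 = 1" "fps_nth (cycle_series True Cs :: 'a fps) 0 = 1"
    by blast+
  fix n :: nat assume "n > 0"
  have "(\<Sum>i\<le>n. (-1) ^ i * fps_nth (cycle_series True Cs) i * fps_nth (cycle_series False Cs) (n - i)) =
      fps_nth (alternate_signs (cycle_series True Cs) * cycle_series False Cs :: 'a fps) n"
    by (simp add: fps_mult_nth alternate_signs_def atLeast0AtMost)
  then show "(\<Sum>i\<le>n. (-1) ^ i * fps_nth (cycle_series True Cs) i * fps_nth (cycle_series False Cs) (n - i)) = (0::'a)"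
    using \<open>n > 0\<close> by (simp add: cycle_series_duality assms)
qed

text \<open>Both sides satisfy Newton's recursion with the same power sums.\<close>

theorem sum_cycle_series_coeffs:
  "(\<Sum>w | w permutes {..<n}. fps_nth (cycle_series s (cycles {..<n} w)) a * fps_nth (cycle_series t (cycles {..<n} w)) b) =
   (fact n * of_nat (arrangements s t n a b) :: 'a::field_char_0)"
proof -
  let ?G = "\<lambda>k. tensor (power_sum s k) (power_sum t k) :: 'a fps fps"
  have "cycle_sum ?G {..<n} = of_nat (fact (card {..<n})) * arrangement_series s t (card {..<n})"
    by (rule cycle_sum_newton) (simp_all only: finite_lessThan arrangement_series_0 arrangement_series_newton)
  also have "\<dots> = fps_const (fps_const (of_nat (fact n))) * arrangement_series s t n"
    by (simp only: card_lessThan fps_of_nat)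
  finally have "fps_nth (fps_nth (cycle_sum ?G {..<n}) b) a = fact n * of_nat (arrangements s t n a b)"
    by (simp add: arrangement_series_def)
  then show ?thesis
    by (simp add: cycle_sum_def tensor_prod fps_sum_nth tensor_nth cycle_series_def)
qed


lemma eval_cp_S_poly:
  assumes "w permutes {..<n}"
  shows "eval_cp (\<lambda>k. of_nat (cycle_count n w (Suc k))) (S_poly lam) =
    (jacobi_trudi (fps_nth (cycle_series False (cycles {..<n} w))) lam :: 'a::field_char_0)"
proof -
  let ?x = "\<lambda>k. of_nat (cycle_count n w (Suc k)) :: 'a"
  have "eval_cp ?x (H_poly d) = extend_by_0 (fps_nth (cycle_series False (cycles {..<n} w))) d" for d
  proof (cases "d < 0")
    case True
    then show ?thesis by (simp add: H_poly_def extend_by_0_def)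
  next
    case False
    have "cycle_series False (cycles {..<n} w) = (complete_series (cycles {..<n} w) :: 'a fps)"
      by (rule cycle_series_False) (use card_cycle(1)[OF finite_lessThan assms] in \<open>simp add: Suc_le_eq\<close>)
    then show ?thesis
      using False eval_cp_H_poly[OF assms, of "nat d", where 'a = 'a] by (simp add: extend_by_0_def)
  qed
  then have "map_mat (eval_cp ?x) (Matrix.mat (length lam) (length lam)
      (\<lambda>(i, j). H_poly (int (lam ! i) + int j - int i))) = jacobi_trudi_mat (fps_nth (cycle_series False (cycles {..<n} w))) lam"
    by (intro eq_matI) (auto simp: jacobi_trudi_mat_def)
  then show ?thesis
    unfolding jacobi_trudi_def S_poly_def by (simp flip: eval_cp.hom_det)
qed

lemma moment_S_poly:
  "moment (S_poly lam) n =
   ((\<Sum>w | w permutes {..<n}. jacobi_trudi (fps_nth (cycle_series False (cycles {..<n} w))) lam) / fact n :: 'a::field_char_0)"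
  unfolding moment_def by (simp add: eval_cp_S_poly)

lemma dual_sequences_permutation:
  assumes "w permutes {..<n :: nat}"
  shows "dual_sequences (fps_nth (cycle_series False (cycles {..<n} w)))
    (fps_nth (cycle_series True (cycles {..<n} w) :: 'a::field_char_0 fps))"
  by (rule dual_sequences_cycle_series) (use card_cycle(1)[OF finite_lessThan assms] in \<open>simp add: Suc_le_eq\<close>)

lemma stable_momentI:
  assumes "\<And>n. n \<ge> N \<Longrightarrow> moment q n = c"
  shows "stable_moment q = c"
  unfolding stable_moment_def
proof (rule the_equality)
  show c: "\<forall>\<^sub>F n in sequentially. moment q n = c"
    using assms by (auto simp: eventually_sequentially)
  fix c' assume "\<forall>\<^sub>F n in sequentially. moment q n = c'"
  with c have "\<forall>\<^sub>F n in sequentially. c' = c" by eventually_elim simp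
  then show "c' = c" by simp
qed

lemma rat_positive_of_int: "rat_positive (of_int c :: 'a::field_char_0) \<longleftrightarrow> c > 0"
proof
  assume "rat_positive (of_int c :: 'a)"
  then obtain r :: rat where r: "r > 0" "of_rat (of_int c) = (of_rat r :: 'a)"
    by (auto simp: rat_positive_def)
  then have "of_int c = r" by (simp only: of_rat_eq_iff)
  with r show "c > 0" by simp
next
  assume "c > 0"
  then show "rat_positive (of_int c :: 'a)"
    unfolding rat_positive_def by (intro exI[of _ "of_int c"]) simp
qed

section \<open>Stable counts\<close>

text \<open>The arrangements without their zero vectors. They do not depend on \<open>n\<close>.\<close>

definition patterns :: "bool \<Rightarrow> bool \<Rightarrow> nat \<Rightarrow> nat \<Rightarrow> (nat \<times> nat) multiset set" where
  "patterns s t a b = {M \<in> vec.super_msets s t. (0, 0) \<notin># M \<and> \<Sum>\<^sub># M = (a, b)}"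

lemma size_le_sum:
  fixes M :: "(nat \<times> nat) multiset"
  assumes "(0, 0) \<notin># M"
  shows "size M \<le> fst (\<Sum>\<^sub># M) + snd (\<Sum>\<^sub># M)"
  using assms
proof (induction M)
  case (add v M)
  then have "fst v + snd v \<ge> 1" by (cases v) (auto simp: Suc_le_eq)
  then show ?case using add by simp
qed simp

text \<open>A pattern of total \<open>(a, b)\<close> has at most \<open>a + b\<close> vectors, so for larger
  \<open>n\<close> there is room to fill up with zero vectors, which are even.\<close>

lemma bij_betw_patterns:
  assumes "a + b \<le> n"
  shows "bij_betw (\<lambda>M. M + replicate_mset (n - size M) (0, 0)) (patterns s t a b)
    {M \<in> vec.super_msets s t. size M = n \<and> \<Sum>\<^sub># M = (a, b)}"
proof (rule bij_betwI[where g = "filter_mset (\<lambda>v. v \<noteq> (0, 0))"])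
  have even: "\<not> odd_vector s t (0, 0)" and mem: "(0, 0) \<in> letters s \<times> letters t"
    by (auto simp: odd_vector_def letters_def)
  show "(\<lambda>M. M + replicate_mset (n - size M) (0, 0)) \<in> patterns s t a b \<rightarrow>
      {M \<in> vec.super_msets s t. size M = n \<and> \<Sum>\<^sub># M = (a, b)}"
  proof
    fix M assume M: "M \<in> patterns s t a b"
    then have "size M \<le> n" using size_le_sum[of M] assms by (simp add: patterns_def)
    moreover have "M + replicate_mset (n - size M) (0, 0) \<in> vec.super_msets s t"
      using M even mem
      by (auto simp: patterns_def vec.super_msets_def in_replicate_mset split: if_splits)
    ultimately show "M + replicate_mset (n - size M) (0, 0) \<in>
        {M \<in> vec.super_msets s t. size M = n \<and> \<Sum>\<^sub># M = (a, b)}"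
      using M by (simp add: patterns_def sum_mset_replicate_vector)
  qed
  have split: "filter_mset (\<lambda>v. v \<noteq> (0, 0)) M + replicate_mset (count M (0, 0)) (0, 0) = M"
    for M :: "(nat \<times> nat) multiset"
    by (rule multiset_eqI) auto
  have zero: "\<Sum>\<^sub># (replicate_mset k (0, 0)) = (0 :: nat \<times> nat)" for k
    by (simp add: sum_mset_replicate_vector zero_prod_def)
  have size: "size M = size (filter_mset (\<lambda>v. v \<noteq> (0, 0)) M) + count M (0, 0)"
    and sum: "\<Sum>\<^sub># M = \<Sum>\<^sub># (filter_mset (\<lambda>v. v \<noteq> (0, 0)) M)"
    for M :: "(nat \<times> nat) multiset"
    using arg_cong[OF split[of M], of size] arg_cong[OF split[of M], of sum_mset]
    by (simp_all add: zero)
  show "filter_mset (\<lambda>v. v \<noteq> (0, 0)) \<in>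
      {M \<in> vec.super_msets s t. size M = n \<and> \<Sum>\<^sub># M = (a, b)} \<rightarrow> patterns s t a b"
    by (auto simp: patterns_def vec.super_msets_def simp flip: sum)
  show "filter_mset (\<lambda>v. v \<noteq> (0, 0)) (M + replicate_mset (n - size M) (0, 0)) = M"
    if "M \<in> patterns s t a b" for M
    using that by (intro multiset_eqI) (auto simp: patterns_def not_in_iff)
  show "filter_mset (\<lambda>v. v \<noteq> (0, 0)) M +
      replicate_mset (n - size (filter_mset (\<lambda>v. v \<noteq> (0, 0)) M)) (0, 0) = M"
    if "M \<in> {M \<in> vec.super_msets s t. size M = n \<and> \<Sum>\<^sub># M = (a, b)}" for M
  proof -
    have "n - size (filter_mset (\<lambda>v. v \<noteq> (0, 0)) M) = count M (0, 0)" using that size[of M] by auto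
    then show ?thesis using split[of M] by simp
  qed
qed

lemma finite_patterns: "finite (patterns s t a b)"
proof -
  have "finite {M \<in> vec.super_msets s t. size M = a + b \<and> \<Sum>\<^sub># M = (a, b)}"
    by (rule finite_subset[OF _ finite_msets_sum]) blast
  then show ?thesis using bij_betw_finite[OF bij_betw_patterns[of a b "a + b" s t]] by simp
qed

lemma arrangements_stable:
  assumes "a + b \<le> n"
  shows "arrangements s t n a b = card (patterns s t a b)"
  unfolding arrangements_def using bij_betw_same_card[OF bij_betw_patterns[OF assms]] by simp

lemma mean_product:
  assumes "a + b \<le> n"
  shows "(\<Sum>w | w permutes {..<n}. fps_nth (cycle_series s (cycles {..<n} w)) a * fps_nth (cycle_series t (cycles {..<n} w)) b) =
   (fact n * of_nat (card (patterns s t a b)) :: 'a::field_char_0)"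
  by (simp add: sum_cycle_series_coeffs arrangements_stable[OF assms])

section \<open>Shapes with two columns\<close>

lemma patterns_True_True:
  "M \<in> patterns True True a b \<longleftrightarrow> (\<exists>c x y. x \<le> 1 \<and> y \<le> 1 \<and> c + x = a \<and> c + y = b \<and>
    M = replicate_mset c (1, 1) + replicate_mset x (1, 0) + replicate_mset y (0, 1))"
proof
  assume M: "M \<in> patterns True True a b"
  then have "set_mset M \<subseteq> letters True \<times> letters True" and nz: "(0, 0) \<notin># M"
    by (simp_all add: patterns_def vec.super_msets_def)
  then have letters: "set_mset M \<subseteq> {0, 1} \<times> {0, 1}" by (simp add: letters_def)
  have sub: "set_mset M \<subseteq> {(1, 1), (1, 0), (0, 1)}"
  proof
    fix v assume v: "v \<in># M"
    then have "v \<in> {0, 1} \<times> {0, 1}" "v \<noteq> (0, 0)" using letters nz by (blast, metis)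
    then show "v \<in> {(1, 1), (1, 0), (0, 1)}" by (cases v) auto
  qed
  have le: "count M (1, 0) \<le> 1" "count M (0, 1) \<le> 1"
    using M by (auto simp: patterns_def vec.super_msets_def odd_vector_def)
  have eq: "M = replicate_mset (count M (1, 1)) (1, 1) + replicate_mset (count M (1, 0)) (1, 0) +
      replicate_mset (count M (0, 1)) (0, 1)"
    using sub by (intro multiset_eqI) (auto simp: not_in_iff[symmetric])
  have "\<Sum>\<^sub># M = (a, b)" using M by (simp add: patterns_def)
  moreover have "\<Sum>\<^sub># M = (count M (1, 1) + count M (1, 0), count M (1, 1) + count M (0, 1))"
    by (rule trans[OF arg_cong[OF eq, of sum_mset]]) (simp add: sum_mset_replicate_vector)
  ultimately have "count M (1, 1) + count M (1, 0) = a" "count M (1, 1) + count M (0, 1) = b"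
    by simp_all
  then show "\<exists>c x y. x \<le> 1 \<and> y \<le> 1 \<and> c + x = a \<and> c + y = b \<and>
      M = replicate_mset c (1, 1) + replicate_mset x (1, 0) + replicate_mset y (0, 1)"
    using le eq by metis
next
  assume "\<exists>c x y. x \<le> 1 \<and> y \<le> 1 \<and> c + x = a \<and> c + y = b \<and>
      M = replicate_mset c (1, 1) + replicate_mset x (1, 0) + replicate_mset y (0, 1)"
  then obtain c x y where *: "x \<le> 1" "y \<le> 1" "c + x = a" "c + y = b"
    and M: "M = replicate_mset c (1, 1) + replicate_mset x (1, 0) + replicate_mset y (0, 1)"
    by blast
  have sub: "set_mset M \<subseteq> {(1, 1), (1, 0), (0, 1)}" by (auto simp: M)
  have "count M v \<le> 1" if "odd_vector True True v" for v
  proof (cases "v \<in># M")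
    case True
    with sub that have "v = (1, 0) \<or> v = (0, 1)" by (auto simp: odd_vector_def)
    then show ?thesis using *(1,2) by (auto simp: M)
  next
    case False
    then show ?thesis by (metis not_in_iff zero_le)
  qed
  moreover have "\<Sum>\<^sub># M = (a, b)" using *(3,4) by (simp add: M sum_mset_replicate_vector)
  moreover have "(0, 0) \<notin># M" using sub by auto
  moreover have "set_mset M \<subseteq> letters True \<times> letters True"
    by (rule subset_trans[OF sub]) (simp add: letters_def)
  ultimately show "M \<in> patterns True True a b"
    unfolding patterns_def vec.super_msets_def mem_Collect_eq by blast
qed

lemma patterns_True_TrueI:
  "x \<le> 1 \<Longrightarrow> y \<le> 1 \<Longrightarrow>
    replicate_mset c (1, 1) + replicate_mset x (1, 0) + replicate_mset y (0, 1) \<in> patterns True True (c + x) (c + y)"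
  unfolding patterns_True_True by metis

lemma card_patterns_True_True_diagonal:
  assumes "m \<ge> 1"
  shows "card (patterns True True m m) = 2"
proof -
  let ?M = "replicate_mset m (1, 1) :: (nat \<times> nat) multiset"
  let ?N = "replicate_mset (m - 1) (1, 1) + {#(1, 0)#} + {#(0, 1)#} :: (nat \<times> nat) multiset"
  have "patterns True True m m = {?M, ?N}"
  proof (intro Set.set_eqI iffI)
    fix M assume "M \<in> patterns True True m m"
    then obtain c x y where *: "x \<le> 1" "c + x = m" "c + y = m"
      "M = replicate_mset c (1, 1) + replicate_mset x (1, 0) + replicate_mset y (0, 1)"
      unfolding patterns_True_True by blast
    show "M \<in> {?M, ?N}"
    proof (cases "x = 0")
      case True
      with * have "y = 0" "c = m" by auto
      with True *(4) show ?thesis by simp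
    next
      case False
      with * have "x = 1" "y = 1" "c = m - 1" by auto
      with *(4) show ?thesis by simp
    qed
  next
    fix M assume "M \<in> {?M, ?N}"
    then consider "M = ?M" | "M = ?N" by blast
    then show "M \<in> patterns True True m m"
    proof cases
      case 1
      then show ?thesis
        using patterns_True_TrueI[of 0 0 m] by simp
    next
      case 2
      then show ?thesis
        using patterns_True_TrueI[of 1 1 "m - 1"] assms by simp
    qed
  qed
  moreover have "count ?M (1, 0) \<noteq> count ?N (1, 0)" by simp
  then have "?M \<noteq> ?N" by metis
  ultimately show ?thesis by simp
qed

lemma card_patterns_True_True_next: "card (patterns True True (Suc m) m) = 1"
proof -
  have "patterns True True (Suc m) m = {replicate_mset m (1, 1) + {#(1, 0)#}}"
  proof (intro Set.set_eqI iffI)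
    fix M assume "M \<in> patterns True True (Suc m) m"
    then obtain c x y where *: "x \<le> 1" "c + x = Suc m" "c + y = m"
      "M = replicate_mset c (1, 1) + replicate_mset x (1, 0) + replicate_mset y (0, 1)"
      unfolding patterns_True_True by blast
    then have "x = 1" "y = 0" "c = m" by auto
    with * show "M \<in> {replicate_mset m (1, 1) + {#(1, 0)#}}" by simp
  next
    fix M :: "(nat \<times> nat) multiset" assume "M \<in> {replicate_mset m (1, 1) + {#(1, 0)#}}"
    then show "M \<in> patterns True True (Suc m) m"
      using patterns_True_TrueI[of 1 0 m] by simp
  qed
  then show ?thesis by simp
qed

lemma card_patterns_True_True_far:
  assumes "b + 2 \<le> a"
  shows "card (patterns True True a b) = 0"
proof -
  have "M \<notin> patterns True True a b" for M
    using assms unfolding patterns_True_True by auto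
  then have "patterns True True a b = {}" by blast
  then show ?thesis by simp
qed

lemma moment_two_columns:
  assumes "2 * m + k + 2 \<le> n"
  shows "moment (S_poly (replicate (Suc m) 2 @ replicate k 1)) n =
    (of_nat (card (patterns True True (Suc m + k) (Suc m))) -
     of_nat (card (patterns True True (Suc (Suc m + k)) m)) :: 'a::field_char_0)"
proof -
  let ?e = "\<lambda>w. fps_nth (cycle_series True (cycles {..<n} w)) :: nat \<Rightarrow> 'a"
  have "jacobi_trudi (fps_nth (cycle_series False (cycles {..<n} w))) (replicate (Suc m) 2 @ replicate k 1) =
      ?e w (Suc m + k) * ?e w (Suc m) - ?e w (Suc (Suc m + k)) * ?e w m" if "w permutes {..<n}" for w
    using dual_sequences.two_columns_Suc[OF dual_sequences_permutation[OF that, where 'a = 'a], of m k]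
    unfolding dual_sequences.two_columns_def[OF dual_sequences_permutation[OF that, where 'a = 'a]] .
  then have "(\<Sum>w | w permutes {..<n}. jacobi_trudi (fps_nth (cycle_series False (cycles {..<n} w))) (replicate (Suc m) 2 @ replicate k 1)) =
      (\<Sum>w | w permutes {..<n}. ?e w (Suc m + k) * ?e w (Suc m) - ?e w (Suc (Suc m + k)) * ?e w m)"
    by (intro sum.cong refl) (simp only: mem_Collect_eq)
  also have "\<dots> = fact n * of_nat (card (patterns True True (Suc m + k) (Suc m))) -
      fact n * of_nat (card (patterns True True (Suc (Suc m + k)) m))"
    unfolding sum_subtractf using assms by (intro arg_cong2[where f = minus] mean_product) simp_all
  finally have sum: "(\<Sum>w | w permutes {..<n}. jacobi_trudi (fps_nth (cycle_series False (cycles {..<n} w)))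
        (replicate (Suc m) 2 @ replicate k 1)) =
      (fact n * of_nat (card (patterns True True (Suc m + k) (Suc m))) -
       fact n * of_nat (card (patterns True True (Suc (Suc m + k)) m)) :: 'a)" .
  show ?thesis unfolding moment_S_poly sum diff_divide_distrib by simp
qed

lemma foldr_max_bound: "p \<in> set lam \<Longrightarrow> p \<le> foldr max lam (0::nat)"
  by (induction lam) auto

lemma two_valued_partition:
  assumes "sorted_wrt (\<ge>) lam" "set lam \<subseteq> {1, 2}"
  shows "lam = replicate (length (filter (\<lambda>p. 1 < p) lam)) 2 @
    replicate (length lam - length (filter (\<lambda>p. 1 < p) lam)) (1::nat)"
  using assms
proof (induction lam)
  case (Cons p lam)
  have IH: "replicate (length (filter (\<lambda>p. 1 < p) lam)) 2 @
      replicate (length lam - length (filter (\<lambda>p. 1 < p) lam)) 1 = lam"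
    by (rule Cons.IH[symmetric]) (use Cons.prems in auto)
  show ?case
  proof (cases "p = 2")
    case True
    then have "length (filter (\<lambda>p. 1 < p) (p # lam)) = Suc (length (filter (\<lambda>p. 1 < p) lam))" by simp
    then show ?thesis by (simp only: list.size replicate_Suc append_Cons True diff_Suc_Suc add_Suc_right add_0_right IH)
  next
    case False
    then have "p = 1" and "\<forall>q\<in>set lam. q \<le> 1 \<and> q \<in> {1, 2}" using Cons.prems by auto
    then have ones: "\<forall>q\<in>set (p # lam). q = 1" by auto
    have "\<forall>q\<in>set (p # lam). \<not> 1 < q"
    proof
      fix q assume "q \<in> set (p # lam)"
      then have "q = 1" using ones by (rule bspec[rotated])
      then show "\<not> 1 < q" by simp
    qed
    then have none: "filter (\<lambda>p. 1 < p) (p # lam) = []" by (rule filter_False)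
    show ?thesis
      unfolding none list.size(3) diff_zero replicate_0 append_Nil
      by (rule replicate_length_same[OF ones, symmetric])
  qed
qed simp

lemma conj_partition_two_parts:
  assumes "is_partition lam" "conj_partition lam = [m1, m2]"
  shows "lam = replicate m2 2 @ replicate (m1 - m2) 1"
proof -
  have max: "foldr max lam 0 = 2"
    using arg_cong[OF assms(2), of length] by (simp add: conj_partition_def)
  have "[0..<2] = [0, 1::nat]" by (simp add: upt_rec)
  then have m: "m1 = length (filter (\<lambda>p. 0 < p) lam)" "m2 = length (filter (\<lambda>p. 1 < p) lam)"
    using assms(2) unfolding conj_partition_def max by (simp_all only: list.map list.inject)
  have nz: "0 \<notin> set lam" using assms(1) by (simp add: is_partition_def)
  then have "filter (\<lambda>p. 0 < p) lam = lam" by (intro filter_True ballI) (metis neq0_conv)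
  then have "m1 = length lam" by (simp only: m(1))
  have "set lam \<subseteq> {1, 2}"
  proof
    fix p assume "p \<in> set lam"
    then have "p \<le> 2" "p \<noteq> 0" using foldr_max_bound[of p lam] max nz by (metis, metis)
    then show "p \<in> {1, 2}" by auto
  qed
  moreover have "sorted_wrt (\<ge>) lam" using assms(1) by (simp add: is_partition_def)
  ultimately have "lam = replicate (length (filter (\<lambda>p. 1 < p) lam)) 2 @
      replicate (length lam - length (filter (\<lambda>p. 1 < p) lam)) 1"
    by (intro two_valued_partition)
  then show ?thesis by (simp only: m(2) \<open>m1 = length lam\<close>)
qed

section \<open>Hooks\<close>

definition partition_msets :: "nat \<Rightarrow> nat multiset set" where
  "partition_msets m = {P. 0 \<notin># P \<and> \<Sum>\<^sub># P = m}"

definition level :: "nat \<times> nat \<Rightarrow> nat" where "level v = fst v + snd v"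

text \<open>A letter \<open>(i, 0)\<close> of the symmetric power is a part \<open>i\<close>, and a letter
  \<open>(i, 1)\<close> is a marked part \<open>i + 1\<close>; the shift lets marked parts be
  positive although \<open>i = 0\<close> is possible. Letters \<open>(i, 1)\<close> are odd, hence
  a size is marked at most once.\<close>

definition mark :: "nat multiset \<Rightarrow> nat set \<Rightarrow> (nat \<times> nat) multiset" where
  "mark P D = image_mset (\<lambda>p. (p, 0)) (P - mset_set D) + image_mset (\<lambda>p. (p - 1, 1)) (mset_set D)"

lemma sum_level: "(\<Sum>v\<in>#M. level v) = fst (\<Sum>\<^sub># M) + snd (\<Sum>\<^sub># M)"
  by (induction M) (auto simp: level_def)

lemma mset_set_subset: "finite D \<Longrightarrow> D \<subseteq> set_mset P \<Longrightarrow> mset_set D \<subseteq># P"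
  by (auto simp: subseteq_mset_def count_mset_set' Suc_le_eq)

lemma level_mark:
  assumes "0 \<notin># P" "D \<subseteq> set_mset P"
  shows "image_mset level (mark P D) = P"
proof -
  have fin: "finite D" using assms(2) finite_subset by blast
  have "image_mset (\<lambda>p. level (p - 1, 1)) (mset_set D) = image_mset (\<lambda>p. p) (mset_set D)"
  proof (rule image_mset_cong)
    fix p assume "p \<in># mset_set D"
    then have "p \<noteq> 0" using assms fin by (cases "p = 0") auto
    then show "level (p - 1, 1) = p" by (simp add: level_def)
  qed
  then have "image_mset level (mark P D) = (P - mset_set D) + mset_set D"
    by (simp add: mark_def multiset.map_comp comp_def) (simp add: level_def)
  also have "\<dots> = P" using mset_set_subset[OF fin assms(2)] by simp
  finally show ?thesis .
qed

lemma bij_betw_mark: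
  "bij_betw (\<lambda>(P, D). mark P D)
    (SIGMA P:partition_msets (a + b). {D. D \<subseteq> set_mset P \<and> card D = b}) (patterns False True a b)"
proof (rule bij_betwI[where g = "\<lambda>M. (image_mset level M, level ` {v \<in> set_mset M. snd v = 1})"])
  have odd: "odd_vector False True v \<longleftrightarrow> snd v = 1" for v
    by (simp add: odd_vector_def)
  have two_levels: "snd v = 0 \<or> snd v = 1" if "M \<in> vec.super_msets False True" "v \<in># M" for M v
  proof -
    have "set_mset M \<subseteq> letters False \<times> letters True" using that(1) by (simp add: vec.super_msets_def)
    then have "v \<in> letters False \<times> letters True" using that(2) by blast
    then show ?thesis by (cases v) (auto simp: letters_def)
  qed
  have marked: "filter_mset (\<lambda>v. snd v = 1) M = mset_set {v \<in> set_mset M. snd v = 1}"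
    if "M \<in> vec.super_msets False True" for M
  proof (rule multiset_eqI)
    fix v
    show "count (filter_mset (\<lambda>v. snd v = 1) M) v = count (mset_set {v \<in> set_mset M. snd v = 1}) v"
    proof (cases "snd v = 1 \<and> v \<in># M")
      case True
      then have "count M v \<le> 1" using that odd[of v] by (simp only: vec.super_msets_def mem_Collect_eq)
      moreover have "count M v \<ge> 1" using True by (simp add: Suc_le_eq)
      ultimately have "count M v = 1" by linarith
      then show ?thesis using True by (simp add: count_mset_set')
    next
      case False
      then show ?thesis by (auto simp: count_mset_set' count_eq_zero_iff)
    qed
  qed
  have inj: "inj_on level {v \<in> set_mset M. snd v = 1}" for M
    by (auto simp: inj_on_def level_def prod_eq_iff)
  have marked_levels: "mset_set (level ` {v \<in> set_mset M. snd v = 1}) =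
      image_mset level (filter_mset (\<lambda>v. snd v = 1) M)" if "M \<in> vec.super_msets False True" for M
    using image_mset_mset_set[OF inj[of M]] marked[OF that] by simp
  have partition: "M = filter_mset (\<lambda>v. snd v = 0) M + filter_mset (\<lambda>v. snd v = 1) M"
    if "M \<in> vec.super_msets False True" for M
  proof -
    have "filter_mset (\<lambda>v. snd v = 0) M = filter_mset (\<lambda>v. \<not> snd v = 1) M"
      using two_levels[OF that] by (intro filter_mset_cong refl) auto
    then show ?thesis by (metis multiset_partition union_commute)
  qed
  show "(\<lambda>(P, D). mark P D) \<in> (SIGMA P:partition_msets (a + b). {D. D \<subseteq> set_mset P \<and> card D = b}) \<rightarrow>
      patterns False True a b"
  proof (rule funcsetI)
    fix x assume "x \<in> (SIGMA P:partition_msets (a + b). {D. D \<subseteq> set_mset P \<and> card D = b})"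
    then obtain P D where x: "x = (P, D)" and P: "P \<in> partition_msets (a + b)"
      and D: "D \<subseteq> set_mset P" and b: "b = card D" by auto
    have nz: "0 \<notin># P" using P by (simp add: partition_msets_def)
    have fin: "finite D" using D finite_subset by blast
    have "snd (\<Sum>\<^sub># (mark P D)) = b"
      unfolding snd_sum_mset by (simp add: mark_def multiset.map_comp comp_def b)
    moreover have "fst (\<Sum>\<^sub># (mark P D)) + snd (\<Sum>\<^sub># (mark P D)) = a + b"
      using P level_mark[OF nz D] by (simp add: partition_msets_def flip: sum_level)
    ultimately have "\<Sum>\<^sub># (mark P D) = (a, b)" by (simp add: prod_eq_iff)
    moreover have "(0, 0) \<notin># mark P D"
    proof
      assume "(0, 0) \<in># mark P D"
      then have "level (0, 0) \<in># image_mset level (mark P D)" unfolding set_image_mset by (rule imageI)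
      then show False using nz by (simp add: level_mark[OF nz D] level_def)
    qed
    moreover have "mark P D \<in> vec.super_msets False True"
    proof -
      have "count (mark P D) (i, 1) \<le> 1" for i
      proof -
        have inj: "inj_on (\<lambda>p. (p - 1, 1::nat)) D"
        proof (rule inj_onI)
          fix p q assume pq: "p \<in> D" "q \<in> D" "(p - 1, 1::nat) = (q - 1, 1)"
          have "r \<noteq> 0" if "r \<in> D" for r using that nz D by (cases "r = 0") auto
          then have "p \<noteq> 0" "q \<noteq> 0" using pq by blast+
          with pq(3) show "p = q" by simp
        qed
        have "count (image_mset (\<lambda>p. (p, 0::nat)) (P - mset_set D)) (i, 1) = 0"
          by (auto simp flip: not_in_iff)
        moreover have "count (image_mset (\<lambda>p. (p - 1, 1::nat)) (mset_set D)) (i, 1) \<le> 1"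
          unfolding image_mset_mset_set[OF inj] by (simp add: count_mset_set')
        ultimately show ?thesis unfolding mark_def count_union by linarith
      qed
      then have "count (mark P D) v \<le> 1" if "snd v = 1" for v
        using that by (cases v) auto
      moreover have "set_mset (mark P D) \<subseteq> letters False \<times> letters True"
        by (auto simp: mark_def letters_def)
      ultimately show ?thesis by (simp add: vec.super_msets_def odd)
    qed
    ultimately show "(case x of (P, D) \<Rightarrow> mark P D) \<in> patterns False True a b" by (simp add: patterns_def x)
  qed
  show "(\<lambda>M. (image_mset level M, level ` {v \<in> set_mset M. snd v = 1})) \<in> patterns False True a b \<rightarrow>
      (SIGMA P:partition_msets (a + b). {D. D \<subseteq> set_mset P \<and> card D = b})"
  proof
    fix M assume M: "M \<in> patterns False True a b"
    then have super: "M \<in> vec.super_msets False True" and nz: "(0, 0) \<notin># M" and sum: "\<Sum>\<^sub># M = (a, b)"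
      by (auto simp: patterns_def)
    have "0 \<notin># image_mset level M"
      using nz by (auto simp: level_def)
    moreover have "\<Sum>\<^sub># (image_mset level M) = a + b" using sum by (simp add: sum_level)
    moreover have "card (level ` {v \<in> set_mset M. snd v = 1}) = b"
    proof -
      have "b = (\<Sum>v\<in>#M. snd v)" using sum by (simp flip: snd_sum_mset)
      also have "\<dots> = (\<Sum>v\<in>#filter_mset (\<lambda>v. snd v = 1) M. snd v)"
        by (subst partition[OF super]) (simp add: sum_mset.neutral)
      also have "\<dots> = (\<Sum>v\<in>#filter_mset (\<lambda>v. snd v = 1) M. 1)"
        by (rule arg_cong[of _ _ sum_mset], rule image_mset_cong) simp
      also have "\<dots> = card {v \<in> set_mset M. snd v = 1}"
        unfolding marked[OF super] by simp
      finally show ?thesis by (simp only: card_image[OF inj])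
    qed
    ultimately show "(image_mset level M, level ` {v \<in> set_mset M. snd v = 1}) \<in>
        (SIGMA P:partition_msets (a + b). {D. D \<subseteq> set_mset P \<and> card D = b})"
      by (auto simp: partition_msets_def)
  qed
  show "(\<lambda>M. (image_mset level M, level ` {v \<in> set_mset M. snd v = 1})) (case x of (P, D) \<Rightarrow> mark P D) = x"
    if "x \<in> (SIGMA P:partition_msets (a + b). {D. D \<subseteq> set_mset P \<and> card D = b})" for x
  proof -
    obtain P D where x: "x = (P, D)" by (cases x)
    with that have nz: "0 \<notin># P" and D: "D \<subseteq> set_mset P" by (auto simp: partition_msets_def)
    have fin: "finite D" using D finite_subset by blast
    have "{v \<in> set_mset (mark P D). snd v = 1} = (\<lambda>p. (p - 1, 1)) ` D"
      using fin by (auto simp: mark_def)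
    moreover have "level ` (\<lambda>p. (p - 1, 1)) ` D = D"
    proof -
      have "level (p - 1, 1) = p" if "p \<in> D" for p
        using that nz D by (cases p) (auto simp: level_def)
      then show ?thesis by (simp add: image_image)
    qed
    ultimately show ?thesis by (simp add: x level_mark[OF nz D])
  qed
  show "(case (image_mset level M, level ` {v \<in> set_mset M. snd v = 1}) of (P, D) \<Rightarrow> mark P D) = M"
    if "M \<in> patterns False True a b" for M
  proof -
    have super: "M \<in> vec.super_msets False True" using that by (simp add: patterns_def)
    let ?M0 = "filter_mset (\<lambda>v. snd v = 0) M" and ?M1 = "filter_mset (\<lambda>v. snd v = 1) M"
    have "image_mset level M = image_mset level ?M0 + image_mset level ?M1"
      by (metis partition[OF super] image_mset_union)
    then have diff: "image_mset level M - mset_set (level ` {v \<in> set_mset M. snd v = 1}) = image_mset level ?M0"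
      unfolding marked_levels[OF super] by simp
    have "mark (image_mset level M) (level ` {v \<in> set_mset M. snd v = 1}) =
        image_mset (\<lambda>v. (level v, 0)) ?M0 + image_mset (\<lambda>v. (level v - 1, 1)) ?M1"
      unfolding mark_def diff unfolding marked_levels[OF super] by (simp add: multiset.map_comp comp_def)
    also have "image_mset (\<lambda>v. (level v, 0)) ?M0 = image_mset (\<lambda>v. v) ?M0"
      by (rule image_mset_cong) (auto simp: level_def prod_eq_iff)
    also have "image_mset (\<lambda>v. (level v - 1, 1)) ?M1 = image_mset (\<lambda>v. v) ?M1"
      by (rule image_mset_cong) (auto simp: level_def prod_eq_iff)
    finally show ?thesis using partition[OF super] by simp
  qed
qed

lemma finite_partition_msets: "finite (partition_msets m)"
proof -
  let ?f = "image_mset (\<lambda>p. (p, 0::nat))"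
  have "?f ` partition_msets m \<subseteq> patterns False False m 0"
  proof (rule image_subsetI)
    fix P assume "P \<in> partition_msets m"
    then have "0 \<notin># P" "\<Sum>\<^sub># P = m" by (auto simp: partition_msets_def)
    moreover have "?f P \<in> vec.super_msets False False"
      by (simp add: vec.super_msets_def odd_vector_def) (simp add: letters_def)
    ultimately show "?f P \<in> patterns False False m 0"
      by (auto simp: patterns_def prod_eq_iff fst_sum_mset snd_sum_mset multiset.map_comp comp_def)
  qed
  then have "finite (?f ` partition_msets m)" using finite_patterns by (rule finite_subset)
  moreover have "inj_on ?f (partition_msets m)"
    by (rule inj_on_inverseI[where g = "image_mset fst"]) (simp add: multiset.map_comp comp_def)
  ultimately show ?thesis by (rule finite_imageD)
qed

lemma card_patterns_False_True:
  "card (patterns False True a b) = (\<Sum>P\<in>partition_msets (a + b). card (set_mset P) choose b)"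
proof -
  have "card (patterns False True a b) =
      card (SIGMA P:partition_msets (a + b). {D. D \<subseteq> set_mset P \<and> card D = b})"
    using bij_betw_same_card[OF bij_betw_mark] by simp
  also have "\<dots> = (\<Sum>P\<in>partition_msets (a + b). card {D. D \<subseteq> set_mset P \<and> card D = b})"
    by (rule card_SigmaI) (auto simp: finite_partition_msets)
  also have "\<dots> = (\<Sum>P\<in>partition_msets (a + b). card (set_mset P) choose b)"
    by (simp add: n_subsets)
  finally show ?thesis .
qed

text \<open>The alternating sum of \<open>s choose k\<close> over \<open>k > b\<close>, beginning with a
  plus sign, is \<open>(s - 1) choose b\<close>; this is how the summands arise from the Pieri
  rule.\<close>

definition hook_number :: "nat \<Rightarrow> nat \<Rightarrow> nat" where
  "hook_number a b = (\<Sum>P\<in>partition_msets (Suc (a + b)). (card (set_mset P) - 1) choose b)"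

text \<open>Pascal's rule for each partition; a partition of a positive number has at least one part size,
  so \<open>s - 1\<close> is not truncated.\<close>

lemma hook_number_pieri:
  "card (patterns False True (Suc a) (Suc b)) = hook_number a (Suc b) + hook_number (Suc a) b"
proof -
  have "card (set_mset P) choose Suc b = ((card (set_mset P) - 1) choose Suc b) + ((card (set_mset P) - 1) choose b)"
    if "P \<in> partition_msets (Suc m)" for P m
  proof -
    have "P \<noteq> {#}" using that by (auto simp: partition_msets_def)
    then have "card (set_mset P) \<noteq> 0" by simp
    then obtain c where "card (set_mset P) = Suc c" by (cases "card (set_mset P)") auto
    then show ?thesis by simp
  qed
  then show ?thesis
    unfolding card_patterns_False_True hook_number_def by (simp add: sum.distrib)
qed

lemma sum_hooks:
  assumes "Suc (a + b) \<le> n"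
  shows "(\<Sum>w | w permutes {..<n}. dual_sequences.hook (fps_nth (cycle_series False (cycles {..<n} w))) a b) =
    (fact n * of_nat (hook_number a b) :: 'a::field_char_0)"
  using assms
proof (induction b arbitrary: a)
  case 0
  let ?h = "\<lambda>w. fps_nth (cycle_series False (cycles {..<n} w)) :: nat \<Rightarrow> 'a"
  let ?e = "\<lambda>w. fps_nth (cycle_series True (cycles {..<n} w)) :: nat \<Rightarrow> 'a"
  have "dual_sequences.hook (?h w) a 0 = ?h w (Suc a) * ?e w 0" if "w permutes {..<n}" for w
    using dual_sequences.hook_0[OF dual_sequences_permutation[OF that, where 'a = 'a], of a]
      dual_sequences.e_0[OF dual_sequences_permutation[OF that, where 'a = 'a]] by simp
  then have "(\<Sum>w | w permutes {..<n}. dual_sequences.hook (?h w) a 0) =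
      (\<Sum>w | w permutes {..<n}. ?h w (Suc a) * ?e w 0)"
    by (intro sum.cong refl) simp
  also have "\<dots> = fact n * of_nat (card (patterns False True (Suc a) 0))"
    using 0 by (intro mean_product) simp
  also have "card (patterns False True (Suc a) 0) = hook_number a 0"
    by (simp add: card_patterns_False_True hook_number_def)
  finally show ?case .
next
  case (Suc b)
  let ?h = "\<lambda>w. fps_nth (cycle_series False (cycles {..<n} w)) :: nat \<Rightarrow> 'a"
  let ?e = "\<lambda>w. fps_nth (cycle_series True (cycles {..<n} w)) :: nat \<Rightarrow> 'a"
  have "dual_sequences.hook (?h w) a (Suc b) = ?h w (Suc a) * ?e w (Suc b) - dual_sequences.hook (?h w) (Suc a) b"
    if "w permutes {..<n}" for w
    using dual_sequences.hook_pieri[OF dual_sequences_permutation[OF that, where 'a = 'a], of a b]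
    by (simp add: eq_diff_eq)
  then have "(\<Sum>w | w permutes {..<n}. dual_sequences.hook (?h w) a (Suc b)) =
      (\<Sum>w | w permutes {..<n}. ?h w (Suc a) * ?e w (Suc b) - dual_sequences.hook (?h w) (Suc a) b)"
    by (intro sum.cong refl) simp
  also have "\<dots> = fact n * of_nat (card (patterns False True (Suc a) (Suc b))) -
      fact n * of_nat (hook_number (Suc a) b)"
    unfolding sum_subtractf using Suc by (simp add: mean_product)
  finally show ?case by (simp add: hook_number_pieri algebra_simps)
qed

lemma stable_moment_hook:
  "stable_moment (S_poly (Suc a # replicate b 1)) = (of_nat (hook_number a b) :: 'a::field_char_0)"
proof (rule stable_momentI)
  fix n assume n: "Suc (a + b) \<le> n"
  have "jacobi_trudi (fps_nth (cycle_series False (cycles {..<n} w))) (Suc a # replicate b 1) =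
      (dual_sequences.hook (fps_nth (cycle_series False (cycles {..<n} w))) a b :: 'a)"
    if "w permutes {..<n}" for w
    by (simp add: dual_sequences.hook_def[OF dual_sequences_permutation[OF that]])
  then have "moment (S_poly (Suc a # replicate b 1)) n =
      ((\<Sum>w | w permutes {..<n}. dual_sequences.hook (fps_nth (cycle_series False (cycles {..<n} w))) a b) / fact n :: 'a)"
    unfolding moment_S_poly by (intro arg_cong2[where f = "(/)"] sum.cong refl) simp
  then show "moment (S_poly (Suc a # replicate b 1)) n = (of_nat (hook_number a b) :: 'a)"
    by (simp add: sum_hooks[OF n])
qed

lemma sum_upto_card_le:
  "finite S \<Longrightarrow> 0 \<notin> S \<Longrightarrow> \<Sum>{1..card S} \<le> \<Sum>S" for S :: "nat set"
proof (induction "card S" arbitrary: S)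
  case (Suc k)
  then have S: "finite S" "S \<noteq> {}" by auto
  let ?m = "Max S"
  have m: "?m \<in> S" using S by (rule Max_in)
  have "S \<subseteq> {1..?m}" using S Suc.prems by (auto simp: Suc_le_eq intro: ccontr)
  then have "card S \<le> ?m" using card_mono[of "{1..?m}" S] by simp
  moreover have "\<Sum>{1..card (S - {?m})} \<le> \<Sum>(S - {?m})"
    using Suc m by (intro Suc.hyps(1)) auto
  moreover have "card (S - {?m}) = k" using Suc.hyps(2) m S by simp
  moreover have "\<Sum>S = ?m + \<Sum>(S - {?m})" using sum.remove[OF S(1) m, of "\<lambda>x. x"] by simp
  ultimately show ?case using Suc.hyps(2)[symmetric] by simp
qed simp

lemma sum_upto_choose: "\<Sum>{1..n} = Suc n choose 2"
  by (induction n) (simp_all add: numeral_2_eq_2)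

text \<open>The smallest number that has a partition with \<open>b + 1\<close> different part sizes is
  \<open>1 + \<dots> + (b + 1)\<close>. Conversely \<open>1, \<dots>, b\<close> and one part for
  the remainder, which is larger than \<open>b\<close>, do.\<close>

lemma hook_number_pos: "hook_number a b > 0 \<longleftrightarrow> Suc b choose 2 \<le> a"
proof
  assume "hook_number a b > 0"
  then obtain P where P: "P \<in> partition_msets (Suc (a + b))" "(card (set_mset P) - 1) choose b \<noteq> 0"
    unfolding hook_number_def by (metis (no_types, lifting) not_gr_zero sum.neutral)
  then have "P \<noteq> {#}" by (auto simp: partition_msets_def)
  then have "card (set_mset P) > 0" by (simp add: card_gt_0_iff)
  with P(2) have "Suc b \<le> card (set_mset P)" by (auto simp: binomial_eq_0_iff)
  then have "\<Sum>{1..Suc b} \<le> \<Sum>{1..card (set_mset P)}" by (intro sum_mono2) auto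
  also have "\<dots> \<le> \<Sum>(set_mset P)"
    using P(1) by (intro sum_upto_card_le) (auto simp: partition_msets_def)
  also have "\<dots> = \<Sum>\<^sub># (mset_set (set_mset P))" by (simp add: sum_unfold_sum_mset)
  also have "\<dots> \<le> \<Sum>\<^sub># P"
    using mset_set_subset[of "set_mset P" P] by (metis finite_set_mset le_add1 order_refl subset_mset.add_diff_inverse sum_mset.union)
  also have "\<dots> = Suc (a + b)" using P(1) by (simp add: partition_msets_def)
  finally show "Suc b choose 2 \<le> a" by (simp add: sum_upto_choose[symmetric])
next
  assume le: "Suc b choose 2 \<le> a"
  define p where "p = Suc (a + b) - (Suc b choose 2)"
  define P where "P = add_mset p (mset_set {1..b})"
  have p: "p > b" using le by (simp add: p_def)
  have "\<Sum>\<^sub># (mset_set {1..b}) = (Suc b choose 2)" using sum_unfold_sum_mset[of "\<lambda>x. x" "{1..b}"] sum_upto_choose[of b] by simp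
  then have "P \<in> partition_msets (Suc (a + b))"
    using le p by (auto simp: partition_msets_def P_def p_def)
  moreover have "card (set_mset P) - 1 = b" using p by (simp add: P_def)
  ultimately have "(card (set_mset P) - 1) choose b \<le> hook_number a b"
    unfolding hook_number_def by (intro member_le_sum finite_partition_msets) auto
  with \<open>card (set_mset P) - 1 = b\<close> show "hook_number a b > 0" by simp
qed

section \<open>Shapes with two rows: raising and lowering operators\<close>

text \<open>Polynomials in variables \<open>z_v\<close> indexed by vectors, with monomials written as
  multisets.\<close>

type_synonym vpoly = "(nat \<times> nat) multiset \<Rightarrow>\<^sub>0 rat"

definition scalar :: "rat \<Rightarrow> vpoly" where
  "scalar c = Poly_Mapping.single {#} c"

definition var :: "nat \<times> nat \<Rightarrow> vpoly" where
  "var v = Poly_Mapping.single {#v#} 1"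

lemma scalar_single: "scalar c * Poly_Mapping.single M d = Poly_Mapping.single M (c * d)"
  by (simp add: scalar_def mult_single)

lemma var_single: "var v * Poly_Mapping.single M d = Poly_Mapping.single (add_mset v M) d"
  by (simp add: var_def mult_single)

lemma scalar_of_int: "scalar (of_int k) = of_int k"
  by (simp add: scalar_def flip: zero_multiset_def)

text \<open>The product rule for a monomial, where \<open>\<phi> v\<close> is the derivative of the variable
  \<open>z_v\<close>.\<close>

definition derivation_monomial :: "(nat \<times> nat \<Rightarrow> vpoly) \<Rightarrow> (nat \<times> nat) multiset \<Rightarrow> vpoly" where
  "derivation_monomial \<phi> M = (\<Sum>v\<in>#M. \<phi> v * Poly_Mapping.single (M - {#v#}) 1)"

definition derivation :: "(nat \<times> nat \<Rightarrow> vpoly) \<Rightarrow> vpoly \<Rightarrow> vpoly" where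
  "derivation \<phi> p = (\<Sum>M\<in>Poly_Mapping.keys p. scalar (Poly_Mapping.lookup p M) * derivation_monomial \<phi> M)"

lemma derivation_add: "derivation \<phi> (p + q) = derivation \<phi> p + derivation \<phi> q"
  unfolding derivation_def
  by (rule setsum_keys_plus_distrib) (auto simp: scalar_def single_add distrib_right)

lemma derivation_single: "derivation \<phi> (Poly_Mapping.single M c) = scalar c * derivation_monomial \<phi> M"
  by (cases "c = 0") (auto simp: derivation_def scalar_def)

lemma derivation_monomial_add_mset:
  "derivation_monomial \<phi> (add_mset v M) =
    \<phi> v * Poly_Mapping.single M 1 + var v * derivation_monomial \<phi> M"
proof -
  have "(\<Sum>u\<in>#M. \<phi> u * Poly_Mapping.single (add_mset v M - {#u#}) 1) =
      (\<Sum>u\<in>#M. var v * (\<phi> u * Poly_Mapping.single (M - {#u#}) 1))"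
  proof (intro arg_cong[of _ _ sum_mset] image_mset_cong)
    fix u assume "u \<in># M"
    then have "add_mset v M - {#u#} = add_mset v (M - {#u#})" by (metis add_mset_commute add_mset_remove_trivial insert_DiffM)
    then show "\<phi> u * Poly_Mapping.single (add_mset v M - {#u#}) 1 =
        var v * (\<phi> u * Poly_Mapping.single (M - {#u#}) 1)"
      by (simp add: var_single[symmetric] mult.left_commute)
  qed
  then show ?thesis
    by (simp add: derivation_monomial_def sum_mset_distrib_left multiset.map_comp comp_def)
qed

lemma derivation_var_mult: "derivation \<phi> (var v * q) = \<phi> v * q + var v * derivation \<phi> q"
proof (induction q rule: poly_mapping_additive_induct)
  case (single M c)
  have "derivation \<phi> (var v * Poly_Mapping.single M c) =
      scalar c * (\<phi> v * Poly_Mapping.single M 1 + var v * derivation_monomial \<phi> M)"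
    by (simp only: var_single derivation_single derivation_monomial_add_mset)
  also have "\<dots> = \<phi> v * (scalar c * Poly_Mapping.single M 1) + var v * (scalar c * derivation_monomial \<phi> M)"
    by (simp only: algebra_simps)
  finally show ?case by (simp only: scalar_single mult_1_right derivation_single)
qed (simp add: distrib_left derivation_add)

lemma derivation_scalar_mult: "derivation \<phi> (scalar c * q) = scalar c * derivation \<phi> q"
proof (induction q rule: poly_mapping_additive_induct)
  case (single M d)
  have "scalar (c * d) = scalar c * scalar d" by (simp add: scalar_def mult_single)
  then show ?case by (simp add: scalar_single derivation_single mult.assoc)
qed (simp add: distrib_left derivation_add)

lemma derivation_mult: "derivation \<phi> (p * q) = derivation \<phi> p * q + p * derivation \<phi> q"
proof (induction p rule: poly_mapping_additive_induct)
  case (single M c)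
  show ?case
  proof (induction M)
    case empty
    have "derivation \<phi> (Poly_Mapping.single {#} c) = 0"
      by (simp add: derivation_single derivation_monomial_def)
    then show ?case using derivation_scalar_mult[of \<phi> c q] by (simp add: scalar_def)
  next
    case (add v M)
    let ?s = "Poly_Mapping.single M c"
    have "derivation \<phi> (Poly_Mapping.single (add_mset v M) c * q) = derivation \<phi> (var v * (?s * q))"
      by (simp only: var_single[symmetric] mult.assoc)
    also have "\<dots> = \<phi> v * (?s * q) + var v * (derivation \<phi> ?s * q + ?s * derivation \<phi> q)"
      by (simp only: derivation_var_mult add)
    also have "\<dots> = (\<phi> v * ?s + var v * derivation \<phi> ?s) * q + (var v * ?s) * derivation \<phi> q"
      by (simp only: algebra_simps)
    also have "\<dots> = derivation \<phi> (Poly_Mapping.single (add_mset v M) c) * q +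
        Poly_Mapping.single (add_mset v M) c * derivation \<phi> q"
      by (simp only: derivation_var_mult[symmetric] var_single)
    finally show ?case .
  qed
qed (simp add: distrib_right derivation_add algebra_simps)

lemma derivation_0: "derivation \<phi> 0 = 0"
  by (simp add: derivation_def)

lemma derivation_uminus: "derivation \<phi> (- p) = - derivation \<phi> p"
  using derivation_add[of \<phi> p "- p"] by (simp add: derivation_0 eq_neg_iff_add_eq_0 add.commute)

lemma derivation_diff: "derivation \<phi> (p - q) = derivation \<phi> p - derivation \<phi> q"
  using derivation_add[of \<phi> p "- q"] by (simp add: derivation_uminus)

lemma derivation_sum: "derivation \<phi> (\<Sum>x\<in>X. f x) = (\<Sum>x\<in>X. derivation \<phi> (f x))"
  by (induction X rule: infinite_finite_induct) (simp_all add: derivation_0 derivation_add)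

lemma derivation_of_int: "derivation \<phi> (of_int k) = 0"
  unfolding scalar_of_int[symmetric] scalar_def derivation_single by (simp add: derivation_monomial_def)

lemma derivation_of_int_mult: "derivation \<phi> (of_int k * p) = of_int k * derivation \<phi> p"
  by (simp add: derivation_mult derivation_of_int)

lemma derivation_of_nat_mult: "derivation \<phi> (of_nat k * p) = of_nat k * derivation \<phi> p"
  using derivation_of_int_mult[of \<phi> "int k" p] by simp

lemma derivation_var: "derivation \<phi> (var v) = \<phi> v"
  by (simp add: var_def derivation_single derivation_monomial_def)
    (simp add: scalar_def flip: zero_multiset_def)

lemma derivation_1: "derivation \<phi> 1 = 0"
  using derivation_of_int[of \<phi> 1] by simp

text \<open>Read \<open>z_(i,j)\<close> as the basis vector \<open>x^i y^j\<close> of a symmetric power of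
  the plane: these are the derivations that extend \<open>x \<partial>/\<partial>y\<close> and
  \<open>y \<partial>/\<partial>x\<close>.\<close>

definition raising :: "vpoly \<Rightarrow> vpoly" where
  "raising = derivation (\<lambda>(i, j). of_nat j * var (Suc i, j - 1))"

definition lowering :: "vpoly \<Rightarrow> vpoly" where
  "lowering = derivation (\<lambda>(i, j). of_nat i * var (i - 1, Suc j))"

lemma raising_var: "raising (var (i, j)) = of_nat j * var (Suc i, j - 1)"
  by (simp add: raising_def derivation_var)

lemma lowering_var: "lowering (var (i, j)) = of_nat i * var (i - 1, Suc j)"
  by (simp add: lowering_def derivation_var)

lemma raising_mult: "raising (p * q) = raising p * q + p * raising q" by (simp add: raising_def derivation_mult)
lemma lowering_mult: "lowering (p * q) = lowering p * q + p * lowering q" by (simp add: lowering_def derivation_mult)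
lemma raising_add: "raising (p + q) = raising p + raising q" by (simp add: raising_def derivation_add)
lemma lowering_add: "lowering (p + q) = lowering p + lowering q" by (simp add: lowering_def derivation_add)

lemma raising_lowering_commutator_var: "raising (lowering (var (i, j))) = lowering (raising (var (i, j))) + of_int (int i - int j) * var (i, j)"
proof -
  have "raising (lowering (var (i, j))) = of_nat i * (of_nat (Suc j) * var (i, j))"
    unfolding lowering_var raising_def derivation_of_nat_mult derivation_var by (cases i) simp_all
  moreover have "lowering (raising (var (i, j))) = of_nat j * (of_nat (Suc i) * var (i, j))"
    unfolding raising_var lowering_def derivation_of_nat_mult derivation_var by (cases j) simp_all
  ultimately show ?thesis by (simp add: algebra_simps)
qed

text \<open>The commutator of two derivations is a derivation, so the relation spreads from the variables to
  all monomials.\<close>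

lemma raising_lowering_commutator_monomial:
  assumes "\<Sum>\<^sub># M = (a, b)"
  shows "raising (lowering (Poly_Mapping.single M c)) =
    lowering (raising (Poly_Mapping.single M c)) + of_int (int a - int b) * Poly_Mapping.single M c"
  using assms
proof (induction M arbitrary: a b)
  case empty
  have "raising (Poly_Mapping.single {#} c) = 0" "lowering (Poly_Mapping.single {#} c) = 0"
    by (simp_all add: raising_def lowering_def derivation_single derivation_monomial_def)
  then show ?case using empty by (simp add: raising_def lowering_def derivation_0 zero_prod_def)
next
  case (add v M)
  obtain i j where v: "v = (i, j)" by (cases v)
  obtain a' b' where ab: "\<Sum>\<^sub># M = (a', b')" by (cases "\<Sum>\<^sub># M")
  let ?q = "Poly_Mapping.single M c"
  have IH: "raising (lowering ?q) = lowering (raising ?q) + of_int (int a' - int b') * ?q" by (rule add.IH[OF ab])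
  have "a = i + a'" "b = j + b'" using add.prems by (simp_all add: v ab)
  moreover have "raising (lowering (var v * ?q)) = lowering (raising (var v * ?q)) +
      (of_int (int i - int j) * var v * ?q + var v * (of_int (int a' - int b') * ?q))"
    by (simp add: raising_mult lowering_mult raising_add lowering_add IH raising_lowering_commutator_var v algebra_simps)
  ultimately show ?case by (simp add: var_single algebra_simps)
qed

definition weight_space :: "nat \<Rightarrow> nat \<Rightarrow> vpoly set" where
  "weight_space a b = {p. \<forall>M\<in>Poly_Mapping.keys p. (0, 0) \<notin># M \<and> \<Sum>\<^sub># M = (a, b)}"

lemma weight_space_0: "0 \<in> weight_space a b"
  by (simp add: weight_space_def)

lemma weight_space_add: "p \<in> weight_space a b \<Longrightarrow> q \<in> weight_space a b \<Longrightarrow> p + q \<in> weight_space a b"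
  using keys_add[of p q] by (auto simp: weight_space_def)

lemma weight_space_mult:
  "p \<in> weight_space a b \<Longrightarrow> q \<in> weight_space c d \<Longrightarrow> p * q \<in> weight_space (a + c) (b + d)"
  using keys_mult[of p q] by (fastforce simp: weight_space_def)

lemma weight_space_scalar: "scalar c \<in> weight_space 0 0"
  by (auto simp: weight_space_def scalar_def zero_prod_def)

lemma weight_space_scalar_mult: "p \<in> weight_space a b \<Longrightarrow> scalar c * p \<in> weight_space a b"
  using weight_space_mult[OF weight_space_scalar] by fastforce

lemma weight_space_var: "(i, j) \<noteq> (0, 0) \<Longrightarrow> var (i, j) \<in> weight_space i j"
  by (auto simp: weight_space_def var_def)

lemma weight_space_sum: "(\<And>x. x \<in> X \<Longrightarrow> f x \<in> weight_space a b) \<Longrightarrow> (\<Sum>x\<in>X. f x) \<in> weight_space a b"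
  by (induction X rule: infinite_finite_induct) (auto simp: weight_space_0 weight_space_add)

lemma weight_space_sum_mset:
  "(\<And>x. x \<in># X \<Longrightarrow> f x \<in> weight_space a b) \<Longrightarrow> (\<Sum>x\<in>#X. f x) \<in> weight_space a b"
  by (induction X) (auto simp: weight_space_0 weight_space_add)

lemma weight_space_uminus: "p \<in> weight_space a b \<Longrightarrow> - p \<in> weight_space a b"
  by (simp add: weight_space_def)

lemma weight_space_diff: "p \<in> weight_space a b \<Longrightarrow> q \<in> weight_space a b \<Longrightarrow> p - q \<in> weight_space a b"
  using weight_space_add[of p a b "- q"] weight_space_uminus by simp

lemma weight_space_of_int_mult: "p \<in> weight_space a b \<Longrightarrow> of_int k * p \<in> weight_space a b"
  using weight_space_scalar_mult[of p a b "of_int k"] by (simp only: scalar_of_int)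

lemma weight_space_of_nat_mult: "p \<in> weight_space a b \<Longrightarrow> of_nat k * p \<in> weight_space a b"
  using weight_space_of_int_mult[of p a b "int k"] by simp

lemma weight_space_numeral_mult: "p \<in> weight_space a b \<Longrightarrow> numeral k * p \<in> weight_space a b"
  using weight_space_of_int_mult[of p a b "numeral k"] by simp

lemma weight_space_single:
  "(0, 0) \<notin># M \<Longrightarrow> \<Sum>\<^sub># M = (a, b) \<Longrightarrow> Poly_Mapping.single M c \<in> weight_space a b"
  by (auto simp: weight_space_def)

lemma weight_space_remove:
  assumes "(i, j) \<in># M" "(0, 0) \<notin># M" "\<Sum>\<^sub># M = (a, b)"
  shows "Poly_Mapping.single (M - {#(i, j)#}) c \<in> weight_space (a - i) (b - j)" "i \<le> a" "j \<le> b"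
proof -
  obtain N where M: "M = add_mset (i, j) N" using assms(1) by (metis insert_DiffM)
  then have "(i, j) + \<Sum>\<^sub># N = (a, b)" using assms(3) by simp
  then have "\<Sum>\<^sub># N = (a - i, b - j)" "i \<le> a" "j \<le> b" by (cases "\<Sum>\<^sub># N"; auto)+
  then show "Poly_Mapping.single (M - {#(i, j)#}) c \<in> weight_space (a - i) (b - j)" "i \<le> a" "j \<le> b"
    using assms(2) by (auto simp: M intro: weight_space_single)
qed

lemma lowering_weight_space:
  assumes "p \<in> weight_space (Suc a) b"
  shows "lowering p \<in> weight_space a (Suc b)"
  unfolding lowering_def derivation_def
proof (intro weight_space_sum weight_space_scalar_mult)
  fix M assume "M \<in> Poly_Mapping.keys p"
  then have M: "(0, 0) \<notin># M" "\<Sum>\<^sub># M = (Suc a, b)" using assms by (auto simp: weight_space_def)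
  show "derivation_monomial (\<lambda>(i, j). of_nat i * var (i - 1, Suc j)) M \<in> weight_space a (Suc b)"
    unfolding derivation_monomial_def
  proof (rule weight_space_sum_mset)
    fix v assume "v \<in># M"
    moreover obtain i j where v: "v = (i, j)" by (cases v)
    ultimately have v_in: "(i, j) \<in># M" by simp
    show "(case v of (i, j) \<Rightarrow> of_nat i * var (i - 1, Suc j)) * Poly_Mapping.single (M - {#v#}) 1
        \<in> weight_space a (Suc b)"
    proof (cases i)
      case (Suc k)
      have "var (k, Suc j) * Poly_Mapping.single (M - {#(i, j)#}) 1 \<in>
          weight_space (k + (Suc a - i)) (Suc j + (b - j))"
        by (intro weight_space_mult weight_space_var weight_space_remove[OF v_in M]) simp
      then have "var (k, Suc j) * Poly_Mapping.single (M - {#(i, j)#}) 1 \<in> weight_space a (Suc b)"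
        using weight_space_remove(2,3)[OF v_in M] Suc by simp
      then show ?thesis using Suc v weight_space_of_nat_mult[of _ a "Suc b" i] by (simp add: mult.assoc del: of_nat_Suc)
    qed (simp add: v weight_space_0)
  qed
qed

lemma raising_weight_space:
  assumes "p \<in> weight_space a (Suc b)"
  shows "raising p \<in> weight_space (Suc a) b"
  unfolding raising_def derivation_def
proof (intro weight_space_sum weight_space_scalar_mult)
  fix M assume "M \<in> Poly_Mapping.keys p"
  then have M: "(0, 0) \<notin># M" "\<Sum>\<^sub># M = (a, Suc b)" using assms by (auto simp: weight_space_def)
  show "derivation_monomial (\<lambda>(i, j). of_nat j * var (Suc i, j - 1)) M \<in> weight_space (Suc a) b"
    unfolding derivation_monomial_def
  proof (rule weight_space_sum_mset)
    fix v assume "v \<in># M"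
    moreover obtain i j where v: "v = (i, j)" by (cases v)
    ultimately have v_in: "(i, j) \<in># M" by simp
    show "(case v of (i, j) \<Rightarrow> of_nat j * var (Suc i, j - 1)) * Poly_Mapping.single (M - {#v#}) 1
        \<in> weight_space (Suc a) b"
    proof (cases j)
      case (Suc k)
      have "var (Suc i, k) * Poly_Mapping.single (M - {#(i, j)#}) 1 \<in>
          weight_space (Suc i + (a - i)) (k + (Suc b - j))"
        by (intro weight_space_mult weight_space_var weight_space_remove[OF v_in M]) simp
      then have "var (Suc i, k) * Poly_Mapping.single (M - {#(i, j)#}) 1 \<in> weight_space (Suc a) b"
        using weight_space_remove(2,3)[OF v_in M] Suc by simp
      then show ?thesis using Suc v weight_space_of_nat_mult[of _ "Suc a" b j] by (simp add: mult.assoc del: of_nat_Suc)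
    qed (simp add: v weight_space_0)
  qed
qed

lemma raising_weight_space_0:
  assumes "p \<in> weight_space a 0"
  shows "raising p = 0"
  unfolding raising_def derivation_def
proof (rule sum.neutral, rule ballI)
  fix M assume "M \<in> Poly_Mapping.keys p"
  then have M: "\<Sum>\<^sub># M = (a, 0)" using assms by (auto simp: weight_space_def)
  have "derivation_monomial (\<lambda>(i, j). of_nat j * var (Suc i, j - 1)) M = 0"
    unfolding derivation_monomial_def
  proof (rule sum_mset.neutral, rule ballI)
    fix q assume "q \<in># image_mset (\<lambda>v. (case v of (i, j) \<Rightarrow> of_nat j * var (Suc i, j - 1)) * Poly_Mapping.single (M - {#v#}) 1) M"
    then obtain v where v: "v \<in># M" "q = (case v of (i, j) \<Rightarrow> of_nat j * var (Suc i, j - 1)) * Poly_Mapping.single (M - {#v#}) 1"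
      by auto
    then show "q = 0" using vector_le_sum(2)[OF v(1) M] by (cases v) auto
  qed
  then show "scalar (Poly_Mapping.lookup p M) * derivation_monomial (\<lambda>(i, j). of_nat j * var (Suc i, j - 1)) M = 0"
    by simp
qed

lemma raising_lowering_commutator:
  assumes "p \<in> weight_space a b"
  shows "raising (lowering p) = lowering (raising p) + of_int (int a - int b) * p"
proof -
  have p: "p = (\<Sum>M\<in>Poly_Mapping.keys p. Poly_Mapping.single M (Poly_Mapping.lookup p M))"
    by (rule poly_mapping_eqI) (auto simp: lookup_sum lookup_single when_def not_in_keys_iff_lookup_eq_zero)
  have "raising (lowering (Poly_Mapping.single M (Poly_Mapping.lookup p M))) =
      lowering (raising (Poly_Mapping.single M (Poly_Mapping.lookup p M))) +
      of_int (int a - int b) * Poly_Mapping.single M (Poly_Mapping.lookup p M)"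
    if "M \<in> Poly_Mapping.keys p" for M
    using that assms by (intro raising_lowering_commutator_monomial) (auto simp: weight_space_def)
  then have "(\<Sum>M\<in>Poly_Mapping.keys p. raising (lowering (Poly_Mapping.single M (Poly_Mapping.lookup p M)))) =
      (\<Sum>M\<in>Poly_Mapping.keys p. lowering (raising (Poly_Mapping.single M (Poly_Mapping.lookup p M)))) +
      of_int (int a - int b) * (\<Sum>M\<in>Poly_Mapping.keys p. Poly_Mapping.single M (Poly_Mapping.lookup p M))"
    by (simp add: sum.distrib sum_distrib_left)
  moreover have "raising (lowering (\<Sum>M\<in>X. f M)) = (\<Sum>M\<in>X. raising (lowering (f M)))" "lowering (raising (\<Sum>M\<in>X. f M)) = (\<Sum>M\<in>X. lowering (raising (f M)))"
    for f :: "(nat \<times> nat) multiset \<Rightarrow> vpoly" and X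
    by (simp_all add: raising_def lowering_def derivation_sum)
  ultimately show ?thesis by (metis p)
qed

lemma of_int_mult_eq_0:
  fixes u :: vpoly
  assumes "of_int k * u = 0" "k \<noteq> 0"
  shows "u = 0"
proof (rule poly_mapping_eqI)
  fix M
  have "1 / of_int k * of_int k = (of_int 1 :: rat)" using assms(2) by simp
  then have "scalar (1 / of_int k) * scalar (of_int k) = scalar (of_int 1)"
    using scalar_single[of "1 / of_int k" "{#}" "of_int k"] by (simp only: scalar_def)
  then have "scalar (1 / of_int k) * of_int k = 1" unfolding scalar_of_int by simp
  then have "scalar (1 / of_int k) * (of_int k * u) = u" by (simp only: mult.assoc[symmetric] mult_1_left)
  then show "Poly_Mapping.lookup u M = Poly_Mapping.lookup 0 M"
    using assms(1) by simp
qed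

text \<open>Raising maps an eigenvector of lowering after raising to another one or to zero, and the
  commutator relation makes its eigenvalue even smaller. As the second weight decreases, this ends
  with the vector zero.\<close>

lemma lowering_raising_no_negative_eigenvalue:
  assumes "u \<in> weight_space a b" "b \<le> a" "lowering (raising u) = of_int k * u" "k < 0"
  shows "u = 0"
  using assms
proof (induction b arbitrary: a u k)
  case 0
  then have "of_int k * u = 0" using raising_weight_space_0[OF 0(1)] by (simp add: lowering_def derivation_0)
  then show ?case using 0 of_int_mult_eq_0 by simp
next
  case (Suc b)
  \<comment> \<open>The difference of the two weights of \<open>raising u\<close>.\<close>
  let ?h = "int (Suc a) - int b"
  have Eu: "raising u \<in> weight_space (Suc a) b" using Suc.prems(1) by (rule raising_weight_space)
  have 1: "lowering (raising (raising u)) = raising (lowering (raising u)) - of_int ?h * raising u"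
    using raising_lowering_commutator[OF Eu] by simp
  have 2: "raising (lowering (raising u)) = of_int k * raising u"
    unfolding Suc.prems(3) by (simp only: raising_def derivation_of_int_mult)
  have "lowering (raising (raising u)) = of_int (k - ?h) * raising u"
    unfolding 1 2 by (simp only: of_int_diff left_diff_distrib)
  then have "raising u = 0"
    using Suc.prems(2,4) by (intro Suc.IH[OF Eu, of "k - ?h"]) simp_all
  then have "of_int k * u = 0" using Suc.prems(3) by (simp add: lowering_def derivation_0)
  then show ?case using Suc.prems(4) of_int_mult_eq_0 by simp
qed

text \<open>If \<open>u\<close> is killed, then by the commutator relation
  \<open>lowering (raising u)\<close> is the multiple of \<open>u\<close> by
  \<open>b - a < 0\<close>.\<close>

lemma raising_lowering_injective:
  assumes "u \<in> weight_space a b" "b < a" "raising (lowering u) = 0"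
  shows "u = 0"
proof (rule lowering_raising_no_negative_eigenvalue[OF assms(1)])
  show "lowering (raising u) = of_int (int b - int a) * u"
    using raising_lowering_commutator[OF assms(1)] assms(3) by (simp add: algebra_simps)
qed (use assms in auto)

text \<open>Gaussian elimination: an unknown \<open>x0\<close> that occurs in an equation is solved for,
  which leaves one equation and one unknown fewer.\<close>

lemma underdetermined_system:
  fixes A :: "'x \<Rightarrow> 'y \<Rightarrow> 'a::field"
  assumes "finite Y" "finite X" "card Y < card X"
  shows "\<exists>c. (\<exists>x\<in>X. c x \<noteq> 0) \<and> (\<forall>y\<in>Y. (\<Sum>x\<in>X. c x * A x y) = 0)"
  using assms
proof (induction Y arbitrary: X A rule: finite_induct)
  case empty
  then have "X \<noteq> {}" by auto
  then show ?case by (intro exI[of _ "\<lambda>_. 1"]) auto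
next
  case (insert y Y)
  show ?case
  proof (cases "\<forall>x\<in>X. A x y = 0")
    case True
    have "card Y < card X" using insert by simp
    from insert.IH[OF insert.prems(1) this, of A] True show ?thesis by auto
  next
    case False
    then obtain x0 where x0: "x0 \<in> X" "A x0 y \<noteq> 0" by blast
    let ?X = "X - {x0}"
    define B where "B x y' = A x y' - A x y / A x0 y * A x0 y'" for x y'
    have "card Y < card ?X" using insert x0 by simp
    then obtain c where c: "\<exists>x\<in>?X. c x \<noteq> 0" "\<forall>y'\<in>Y. (\<Sum>x\<in>?X. c x * B x y') = 0"
      using insert.IH[of ?X B] insert.prems by auto
    \<comment> \<open>The value at \<open>x0\<close> solves equation \<open>y\<close>.\<close>
    define d where "d = c(x0 := - (\<Sum>x\<in>?X. c x * A x y) / A x0 y)"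
    have d: "(\<Sum>x\<in>X. d x * A x y') = d x0 * A x0 y' + (\<Sum>x\<in>?X. c x * A x y')" for y'
    proof -
      have "(\<Sum>x\<in>X. d x * A x y') = d x0 * A x0 y' + (\<Sum>x\<in>?X. d x * A x y')"
        using x0 insert.prems by (simp add: sum.remove)
      also have "(\<Sum>x\<in>?X. d x * A x y') = (\<Sum>x\<in>?X. c x * A x y')"
        by (rule sum.cong) (auto simp: d_def)
      finally show ?thesis .
    qed
    have "(\<Sum>x\<in>X. d x * A x y) = 0" unfolding d using x0 by (simp add: d_def)
    moreover have "(\<Sum>x\<in>X. d x * A x y') = 0" if "y' \<in> Y" for y'
    proof -
      have "(\<Sum>x\<in>?X. c x * B x y') =
          (\<Sum>x\<in>?X. c x * A x y') - (\<Sum>x\<in>?X. c x * A x y) / A x0 y * A x0 y'"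
        by (simp add: B_def algebra_simps sum_subtractf sum_distrib_left sum_divide_distrib sum_distrib_right)
      then show ?thesis unfolding d using c(2) that by (simp add: d_def)
    qed
    moreover have "\<exists>x\<in>X. d x \<noteq> 0" using c(1) x0 by (auto simp: d_def)
    ultimately show ?thesis by (intro exI[of _ d]) auto
  qed
qed

definition weight_monomials :: "nat \<Rightarrow> nat \<Rightarrow> (nat \<times> nat) multiset set" where
  "weight_monomials a b = {M. (0, 0) \<notin># M \<and> \<Sum>\<^sub># M = (a, b)}"

text \<open>If there were not more monomials of weight \<open>(a, b + 1)\<close> than of weight
  \<open>(a + 1, b)\<close>, then \<open>v\<close> and the images under lowering of the monomials
  of weight \<open>(a + 1, b)\<close> would be linearly dependent. Applying raising to such a
  relation kills \<open>v\<close>, so injectivity kills the other coefficients, and then that of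
  \<open>v\<close>.\<close>

lemma card_weight_monomials_less:
  assumes v: "v \<in> weight_space a (Suc b)" "v \<noteq> 0" "raising v = 0" and "b \<le> a"
    and fin: "finite (weight_monomials (Suc a) b)" "finite (weight_monomials a (Suc b))"
  shows "card (weight_monomials (Suc a) b) < card (weight_monomials a (Suc b))"
proof (rule ccontr)
  assume neg: "\<not> card (weight_monomials (Suc a) b) < card (weight_monomials a (Suc b))"
  let ?W = "weight_monomials (Suc a) b" and ?Y = "weight_monomials a (Suc b)"
  \<comment> \<open>\<open>None\<close> stands for the coefficient of \<open>v\<close> in the linear relation.\<close>
  let ?X = "insert None (Some ` ?W)"
  define A where "A x = Poly_Mapping.lookup (case x of None \<Rightarrow> v | Some M \<Rightarrow> lowering (Poly_Mapping.single M 1))" for x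
  have "card ?X = Suc (card ?W)" using fin by (simp add: card_image)
  then have "card ?Y < card ?X" using neg by simp
  then obtain c where c: "\<exists>x\<in>?X. c x \<noteq> 0" "\<forall>y\<in>?Y. (\<Sum>x\<in>?X. c x * A x y) = 0"
    using underdetermined_system[OF fin(2), of ?X A] fin(1) by auto
  define u where "u = (\<Sum>M\<in>?W. Poly_Mapping.single M (c (Some M)))"
  have u: "u \<in> weight_space (Suc a) b"
    unfolding u_def by (intro weight_space_sum weight_space_single) (auto simp: weight_monomials_def)
  have lowering_u: "lowering u = (\<Sum>M\<in>?W. scalar (c (Some M)) * lowering (Poly_Mapping.single M 1))"
  proof -
    have "Poly_Mapping.single M (c (Some M)) = scalar (c (Some M)) * Poly_Mapping.single M 1" for M
      by (simp add: scalar_single)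
    then show ?thesis by (simp add: u_def lowering_def derivation_sum derivation_scalar_mult)
  qed
  have lookup_scalar: "Poly_Mapping.lookup (scalar k * p) y = k * Poly_Mapping.lookup p y" for k p y
  proof (induction p rule: poly_mapping_additive_induct)
    case (single M d)
    then show ?case by (simp add: scalar_single lookup_single when_def)
  qed (simp add: distrib_left lookup_add)
  have "scalar (c None) * v + lowering u = 0"
  proof (rule poly_mapping_eqI)
    fix y
    have mem: "scalar (c None) * v + lowering u \<in> weight_space a (Suc b)"
      using v u by (intro weight_space_add weight_space_scalar_mult lowering_weight_space)
    have lookup: "Poly_Mapping.lookup (scalar (c None) * v + lowering u) y = (\<Sum>x\<in>?X. c x * A x y)"
    proof -
      have "(\<Sum>x\<in>?X. c x * A x y) = c None * A None y + (\<Sum>M\<in>?W. c (Some M) * A (Some M) y)"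
        using fin(1) by (subst sum.insert) (auto simp: sum.reindex)
      then show ?thesis by (simp add: lowering_u lookup_add lookup_sum lookup_scalar A_def)
    qed
    show "Poly_Mapping.lookup (scalar (c None) * v + lowering u) y = Poly_Mapping.lookup 0 y"
    proof (cases "y \<in> ?Y")
      case True
      show ?thesis unfolding lookup lookup_zero by (rule bspec[OF c(2) True])
    next
      case False
      then have "y \<notin> Poly_Mapping.keys (scalar (c None) * v + lowering u)"
        using mem unfolding weight_space_def weight_monomials_def by blast
      then show ?thesis by (simp only: not_in_keys_iff_lookup_eq_zero lookup_zero)
    qed
  qed
  then have sum0: "scalar (c None) * v + lowering u = 0" .
  have "raising (scalar (c None) * v + lowering u) = raising (lowering u)"
    using v(3) by (simp add: raising_add) (simp add: raising_def derivation_scalar_mult)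
  then have "raising (lowering u) = 0" using sum0 by (simp add: raising_def derivation_0)
  then have "u = 0" using u assms(4) by (intro raising_lowering_injective[OF u]) auto
  have "c (Some M) = 0" if "M \<in> ?W" for M
  proof -
    have "Poly_Mapping.lookup u M = c (Some M)"
      using that fin(1) by (simp add: u_def lookup_sum lookup_single when_def)
    then show ?thesis using \<open>u = 0\<close> by simp
  qed
  moreover have "c None = 0"
  proof -
    have "scalar (c None) * v = 0" using sum0 \<open>u = 0\<close> by (simp add: lowering_def derivation_0)
    moreover obtain M where "Poly_Mapping.lookup v M \<noteq> 0" using v(2) by (metis poly_mapping_eqI lookup_zero)
    ultimately show ?thesis using lookup_scalar[of "c None" v M] by simp
  qed
  ultimately show False using c(1) by auto
qed

text \<open>The value at a point chosen such that each of the four generating highest weight vectors below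
  has value 1. As evaluation is multiplicative, it certifies that their products are not zero.\<close>

definition point_value :: "vpoly \<Rightarrow> rat" where
  "point_value p = (\<Sum>M\<in>Poly_Mapping.keys p. Poly_Mapping.lookup p M *
     (\<Prod>v\<in>#M. if v \<in> {(1, 0), (0, 1), (2, 0), (0, 2), (3, 0)} then 1 else 0))"

lemma point_value_add: "point_value (p + q) = point_value p + point_value q"
  unfolding point_value_def by (rule setsum_keys_plus_distrib) (auto simp: algebra_simps)

lemma point_value_single: "point_value (Poly_Mapping.single M c) =
    c * (\<Prod>v\<in>#M. if v \<in> {(1, 0), (0, 1), (2, 0), (0, 2), (3, 0)} then 1 else 0)"
  by (cases "c = 0") (auto simp: point_value_def)

lemma point_value_mult: "point_value (p * q) = point_value p * point_value q"
proof (induction p rule: poly_mapping_additive_induct)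
  case (single k c)
  show ?case
  proof (induction q rule: poly_mapping_additive_induct)
    case (single k' c')
    show ?case by (simp add: mult_single point_value_single)
  qed (simp add: distrib_left point_value_add)
qed (simp add: distrib_right point_value_add)

lemma point_value_var: "point_value (var v) = (if v \<in> {(1, 0), (0, 1), (2, 0), (0, 2), (3, 0)} then 1 else 0)"
  by (simp add: var_def point_value_single)

lemma point_value_scalar: "point_value (scalar c) = c"
  by (simp add: scalar_def point_value_single)

lemma point_value_diff: "point_value (p - q) = point_value p - point_value q"
  using point_value_add[of "p - q" q] by simp

lemma point_value_numeral: "point_value (numeral k) = numeral k"
  using point_value_scalar[of "of_int (numeral k)"] by (simp only: scalar_of_int) simp

definition highest_weight :: "nat \<Rightarrow> nat \<Rightarrow> bool" where
  "highest_weight a b \<longleftrightarrow> (\<exists>v\<in>weight_space a b. raising v = 0 \<and> point_value v = 1)"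

lemma highest_weight_add:
  assumes "highest_weight a b" "highest_weight c d"
  shows "highest_weight (a + c) (b + d)"
proof -
  obtain p q where "p \<in> weight_space a b" "raising p = 0" "point_value p = 1"
    "q \<in> weight_space c d" "raising q = 0" "point_value q = 1"
    using assms by (auto simp: highest_weight_def)
  then show ?thesis
    unfolding highest_weight_def
    by (intro bexI[of _ "p * q"]) (auto simp: raising_mult point_value_mult weight_space_mult)
qed

lemma highest_weight_multiple:
  assumes "highest_weight a b"
  shows "highest_weight (n * a) (n * b)"
proof (induction n)
  case 0
  have "scalar 1 = 1" using scalar_of_int[of 1] by simp
  then have "1 \<in> weight_space 0 0" "point_value 1 = 1"
    using weight_space_scalar[of 1] point_value_scalar[of 1] by simp_all
  then show ?case by (auto simp: highest_weight_def raising_def derivation_1 intro!: bexI[of _ 1])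
next
  case (Suc n)
  then show ?case using highest_weight_add[OF assms Suc] by simp
qed

lemma highest_weight_1_0: "highest_weight 1 0"
  unfolding highest_weight_def
  by (rule bexI[of _ "var (1, 0)"]) (simp_all add: raising_var point_value_var weight_space_var)

lemma raising_diff: "raising (p - q) = raising p - raising q" by (simp add: raising_def derivation_diff)

lemma raising_numeral: "raising (numeral k) = 0"
  using derivation_of_int[of _ "numeral k"] by (simp add: raising_def)

lemma weight_space_var_mult:
  "(i, j) \<noteq> (0, 0) \<Longrightarrow> i \<le> a \<Longrightarrow> j \<le> b \<Longrightarrow> p \<in> weight_space (a - i) (b - j) \<Longrightarrow> var (i, j) * p \<in> weight_space a b"
  using weight_space_mult[OF weight_space_var, of i j p "a - i" "b - j"] by simp

lemma weight_space_var': "(a, b) \<noteq> (0, 0) \<Longrightarrow> i = a \<Longrightarrow> j = b \<Longrightarrow> var (i, j) \<in> weight_space a b"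
  using weight_space_var by simp

lemma highest_weight_2_1: "highest_weight 2 1"
  unfolding highest_weight_def
proof (rule bexI)
  let ?v = "var (2, 0) * var (0, 1) - var (1, 1) * var (1, 0)"
  show "?v \<in> weight_space 2 1"
    by (intro weight_space_diff weight_space_var_mult weight_space_var') simp_all
  show "raising ?v = 0 \<and> point_value ?v = 1"
    by (simp add: raising_diff raising_mult raising_var point_value_diff point_value_mult point_value_var numeral_2_eq_2)
qed

lemma highest_weight_2_2: "highest_weight 2 2"
  unfolding highest_weight_def
proof (rule bexI)
  let ?v = "var (2, 0) * var (0, 2) - var (1, 1) * var (1, 1)"
  show "?v \<in> weight_space 2 2"
    by (intro weight_space_diff weight_space_var_mult weight_space_var') simp_all
  show "raising ?v = 0 \<and> point_value ?v = 1"
    by (simp add: raising_diff raising_mult raising_var point_value_diff point_value_mult point_value_var numeral_2_eq_2 algebra_simps)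
qed

text \<open>The invariant in the product of the plane with its second and third symmetric power, made by
  solving the linear system for the six monomials of weight \<open>(3, 3)\<close> of this kind.\<close>

lemma highest_weight_3_3: "highest_weight 3 3"
  unfolding highest_weight_def
proof (rule bexI)
  let ?v = "2 * (var (1, 0) * (var (1, 1) * var (1, 2))) + var (0, 1) * (var (2, 0) * var (1, 2)) +
    var (0, 1) * (var (0, 2) * var (3, 0)) - var (1, 0) * (var (2, 0) * var (0, 3)) -
    var (1, 0) * (var (0, 2) * var (2, 1)) - 2 * (var (0, 1) * (var (1, 1) * var (2, 1)))"
  show "?v \<in> weight_space 3 3"
    by (intro weight_space_diff weight_space_add weight_space_numeral_mult weight_space_var_mult weight_space_var') simp_all
  show "raising ?v = 0 \<and> point_value ?v = 1"
    by (simp add: raising_diff raising_add raising_numeral raising_mult raising_var point_value_diff point_value_add point_value_mult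
        point_value_var point_value_numeral numeral_2_eq_2 numeral_3_eq_3 algebra_simps)
qed

text \<open>All these weights are sums of \<open>(1, 0)\<close>, \<open>(2, 2)\<close>,
  \<open>(2, 1)\<close> and \<open>(3, 3)\<close>: a square part of even size, with a correction
  if \<open>b\<close> is odd, and a row.\<close>

lemma highest_weight_exists:
  assumes "b \<le> a" "(a, b) \<noteq> (1, 1)"
  shows "highest_weight a b"
proof -
  have row: "highest_weight k 0" for k using highest_weight_multiple[OF highest_weight_1_0, of k] by simp
  have square: "highest_weight (2 * k) (2 * k)" for k
    using highest_weight_multiple[OF highest_weight_2_2, of k] by (simp add: mult.commute)
  consider k where "b = 2 * k" | "b = 1" | k where "b = 2 * k + 3"
  proof (cases "even b")
    case True
    then show ?thesis using that(1) by (elim evenE)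
  next
    case False
    then obtain k where "b = 2 * k + 1" by (elim oddE)
    then show ?thesis using that(2) that(3)[of "k - 1"] by (cases k) simp_all
  qed
  then show ?thesis
  proof cases
    case 1
    then show ?thesis using highest_weight_add[OF square[of k] row[of "a - b"]] assms by simp
  next
    case 2
    then have "2 \<le> a" using assms by (cases "a = 1") auto
    then have "2 + (a - 2) = a" "1 + 0 = b" using 2 by simp_all
    then show ?thesis using highest_weight_add[OF highest_weight_2_1 row[of "a - 2"]] by (simp only:)
  next
    case 3
    then have "3 + 2 * k + (a - b) = a" "3 + 2 * k + 0 = b" using assms(1) by simp_all
    then show ?thesis
      using highest_weight_add[OF highest_weight_add[OF highest_weight_3_3 square[of k]] row[of "a - b"]]
      by (simp only:)
  qed
qed

section \<open>The theorem\<close>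

lemma patterns_False_False: "patterns False False a b = weight_monomials a b"
proof -
  have "M \<in> vec.super_msets False False" for M
    by (simp add: vec.super_msets_def odd_vector_def) (simp add: letters_def)
  then show ?thesis by (simp add: patterns_def weight_monomials_def)
qed

lemma finite_weight_monomials: "finite (weight_monomials a b)"
  using finite_patterns[of False False a b] by (simp add: patterns_False_False)

lemma card_weight_monomials_strict:
  assumes "b \<le> a" "(a, Suc b) \<noteq> (1, 1)" "Suc b \<le> a"
  shows "card (weight_monomials (Suc a) b) < card (weight_monomials a (Suc b))"
proof -
  obtain v where v: "v \<in> weight_space a (Suc b)" "raising v = 0" "point_value v = 1"
    using highest_weight_exists[OF assms(3,2)] by (auto simp: highest_weight_def)
  have "v \<noteq> 0" using v(3) by (auto simp: point_value_def)
  then show ?thesis using v assms by (intro card_weight_monomials_less[of v] finite_weight_monomials) simp_all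
qed

lemma (in dual_sequences) jacobi_trudi_one_row: "jacobi_trudi h [k] = h k"
proof (cases k)
  case 0
  then show ?thesis using jacobi_trudi_append_0[of h "[]", OF h_0] by (simp add: jacobi_trudi_Nil h_0)
next
  case (Suc a)
  then show ?thesis using hook_0[of a] by (simp add: hook_def)
qed

lemma (in dual_sequences) jacobi_trudi_two_rows: "jacobi_trudi h [Suc a, Suc b] = h (Suc a) * h (Suc b) - h (Suc (Suc a)) * h b"
  using jacobi_trudi_expand_last_column[of "[Suc a, Suc b]" 1 h]
  by (simp add: jacobi_trudi_one_row mult.commute)

lemma stable_moment_two_rows:
  "stable_moment (S_poly [Suc a, Suc b]) =
    (of_int (int (card (weight_monomials (Suc a) (Suc b))) - int (card (weight_monomials (Suc (Suc a)) b))) :: 'a::field_char_0)"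
proof (rule stable_momentI)
  fix n assume n: "Suc a + Suc b \<le> n"
  let ?h = "\<lambda>w. fps_nth (cycle_series False (cycles {..<n} w)) :: nat \<Rightarrow> 'a"
  have "jacobi_trudi (?h w) [Suc a, Suc b] = ?h w (Suc a) * ?h w (Suc b) - ?h w (Suc (Suc a)) * ?h w b"
    if "w permutes {..<n}" for w
    by (rule dual_sequences.jacobi_trudi_two_rows[OF dual_sequences_permutation[OF that]])
  then have "(\<Sum>w | w permutes {..<n}. jacobi_trudi (?h w) [Suc a, Suc b]) =
      (\<Sum>w | w permutes {..<n}. ?h w (Suc a) * ?h w (Suc b) - ?h w (Suc (Suc a)) * ?h w b)"
    by (intro sum.cong refl) (simp only: mem_Collect_eq)
  also have "\<dots> = fact n * of_nat (card (patterns False False (Suc a) (Suc b))) -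
      fact n * of_nat (card (patterns False False (Suc (Suc a)) b))"
    unfolding sum_subtractf using n by (intro arg_cong2[where f = minus] mean_product) simp_all
  finally have sum: "(\<Sum>w | w permutes {..<n}. jacobi_trudi (?h w) [Suc a, Suc b]) =
      fact n * of_nat (card (patterns False False (Suc a) (Suc b))) -
      fact n * of_nat (card (patterns False False (Suc (Suc a)) b))" .
  show "moment (S_poly [Suc a, Suc b]) n =
      (of_int (int (card (weight_monomials (Suc a) (Suc b))) - int (card (weight_monomials (Suc (Suc a)) b))) :: 'a)"
    unfolding moment_S_poly sum diff_divide_distrib patterns_False_False by simp
qed

lemma rat_positive_of_nat: "rat_positive (of_nat c :: 'a::field_char_0) \<longleftrightarrow> c > 0"
  using rat_positive_of_int[of "int c", where 'a = 'a] by simp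

lemma stable_moment_two_columns:
  "stable_moment (S_poly (replicate (Suc m) 2 @ replicate k 1)) =
    (if k = 0 then 2 else if k = 1 then 1 else 0 :: 'a::field_char_0)"
proof (rule stable_momentI)
  fix n assume "2 * m + k + 2 \<le> n"
  from moment_two_columns[OF this, where 'a = 'a]
  have eq: "moment (S_poly (replicate (Suc m) 2 @ replicate k 1)) n =
    (of_nat (card (patterns True True (Suc m + k) (Suc m))) -
     of_nat (card (patterns True True (Suc (Suc m + k)) m)) :: 'a)" .
  have "card (patterns True True (Suc (Suc m + k)) m) = 0"
    by (rule card_patterns_True_True_far) simp
  moreover have "card (patterns True True (Suc m + k) (Suc m)) = (if k = 0 then 2 else if k = 1 then 1 else 0)"
  proof -
    consider "k = 0" | "k = 1" | "2 \<le> k" by linarith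
    then show ?thesis
    proof cases
      case 1
      then show ?thesis using card_patterns_True_True_diagonal[of "Suc m"] by simp
    next
      case 2
      then show ?thesis using card_patterns_True_True_next[of "Suc m"] by simp
    next
      case 3
      then show ?thesis using card_patterns_True_True_far[of "Suc m" "Suc m + k"] by simp
    qed
  qed
  ultimately show "moment (S_poly (replicate (Suc m) 2 @ replicate k 1)) n =
      (if k = 0 then 2 else if k = 1 then 1 else 0 :: 'a)"
    unfolding eq by simp
qed

theorem theorem4p8:
  fixes lam :: "nat list"
  assumes "is_partition lam"
  shows
    "(\<forall>l1 l2. l1 \<ge> l2 \<and> l2 \<ge> 1 \<and> lam = [l1, l2] \<longrightarrow>
        (rat_positive (stable_moment (S_poly lam :: 'a::field_char_0 charpoly)) \<longleftrightarrow> lam \<noteq> [1, 1]))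
     \<and>
     (\<forall>m1 m2. m1 \<ge> m2 \<and> m2 \<ge> 1 \<and> conj_partition lam = [m1, m2] \<longrightarrow>
        (rat_positive (stable_moment (S_poly lam :: 'a charpoly)) \<longleftrightarrow> m1 = m2 \<or> m1 = m2 + 1) \<and>
        (m1 = m2 \<longrightarrow> stable_moment (S_poly lam :: 'a charpoly) = 2) \<and>
        (m1 = m2 + 1 \<longrightarrow> stable_moment (S_poly lam :: 'a charpoly) = 1))
     \<and>
     (\<forall>a b. lam = (a + 1) # replicate b 1 \<longrightarrow>
        (rat_positive (stable_moment (S_poly lam :: 'a charpoly)) \<longleftrightarrow> a \<ge> (b + 1) choose 2))"
proof (intro conjI allI impI)
  have hook: "rat_positive (stable_moment (S_poly (Suc a # replicate b 1) :: 'a charpoly)) \<longleftrightarrow>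
      Suc b choose 2 \<le> a" for a b
    by (simp only: stable_moment_hook rat_positive_of_nat hook_number_pos)
  show "rat_positive (stable_moment (S_poly lam :: 'a charpoly)) \<longleftrightarrow> a \<ge> (b + 1) choose 2"
    if "lam = (a + 1) # replicate b 1" for a b
    using hook[of a b] that by simp
  show "rat_positive (stable_moment (S_poly lam :: 'a charpoly)) \<longleftrightarrow> lam \<noteq> [1, 1]"
    if l: "l1 \<ge> l2 \<and> l2 \<ge> 1 \<and> lam = [l1, l2]" for l1 l2
  proof (cases "lam = [1, 1]")
    case True
    \<comment> \<open>The shape \<open>(1, 1)\<close> is the hook with \<open>a = 0\<close> and \<open>b = 1\<close>, which fails the criterion for hooks.\<close>
    then have "lam = Suc 0 # replicate 1 1" by simp
    then show ?thesis using hook[of 0 1] True by simp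
  next
    case False
    obtain a b where ab: "l1 = Suc a" "l2 = Suc b" using l by (cases l1; cases l2) auto
    have "card (weight_monomials (Suc (Suc a)) b) < card (weight_monomials (Suc a) (Suc b))"
      using l False ab by (intro card_weight_monomials_strict) auto
    then have "rat_positive (stable_moment (S_poly [Suc a, Suc b] :: 'a charpoly))"
      unfolding stable_moment_two_rows rat_positive_of_int by simp
    then show ?thesis using False l ab by simp
  qed
  fix m1 m2 assume m: "m1 \<ge> m2 \<and> m2 \<ge> 1 \<and> conj_partition lam = [m1, m2]"
  then obtain m where m2: "m2 = Suc m" by (cases m2) auto
  have "lam = replicate (Suc m) 2 @ replicate (m1 - m2) 1"
    using conj_partition_two_parts[OF assms, of m1 m2] m m2 by simp
  then have moment_lam: "stable_moment (S_poly lam) =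
      (if m1 - m2 = 0 then 2 else if m1 - m2 = 1 then 1 else 0 :: 'a)"
    by (simp only: stable_moment_two_columns)
  show "m1 = m2 \<Longrightarrow> stable_moment (S_poly lam :: 'a charpoly) = 2"
    "m1 = m2 + 1 \<Longrightarrow> stable_moment (S_poly lam :: 'a charpoly) = 1"
    by (simp_all add: moment_lam)
  have "stable_moment (S_poly lam) = (of_nat (if m1 - m2 = 0 then 2 else if m1 - m2 = 1 then 1 else 0) :: 'a)"
    by (simp add: moment_lam)
  then show "rat_positive (stable_moment (S_poly lam :: 'a charpoly)) \<longleftrightarrow> m1 = m2 \<or> m1 = m2 + 1"
    using m by (auto simp only: rat_positive_of_nat split: if_splits)
qed

end
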